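(* Let $n\ge1$ and let $\Lambda_{-},\Lambda_{+}$ be two closed, orientable (connected, chord generic) Legendrian submanifolds of $\mathbb{R}^{2n+1}$ that are Legendrian isotopic. Then there exists an embedded exact Lagrangian cobordism $L$ from $\Lambda_-$ to $\Lambda_+$, i.e. $\Lambda_{-}\prec^{ex}_{L}\Lambda_{+}$.
   Context: $\mathbb{R}^{2n+1}$ has coordinates $(x_1,y_1,\dots,x_n,y_n,z)$, contact form $\alpha=dz-\sum_{i=1}^n y_i\,dx_i$ and contact structure $\xi=\ker\alpha$. A Legendrian submanifold is an $n$-dimensional submanifold $\Lambda$ tangent to $\xi$ everywhere. $\Lambda$ is chord generic if the self-intersection of its image under the projection $(x_1,y_1,\dots,x_n,y_n,z)\mapsto(x_1,y_1,\dots,x_n,y_n)$ consists of finitely many transverse double points. $\Lambda_-$ and $\Lambda_+$ are Legendrian isotopic if they are joined by a smooth isotopy through (embedded) Legendrian submanifolds. The symplectization is $(\mathbb{R}\times\mathbb{R}^{2n+1},d(e^t\alpha))$, with $t$ the coordinate on $\mathbb{R}$. An embedded cobordism from $\Lambda_-$ to $\Lambda_+$ is a smooth cobordism $(L;\Lambda_-,\Lambda_+)$ embedded in $\mathbb{R}\times\mathbb{R}^{2n+1}$ such that for some $T_L\gg0$ one has $L\cap((-\infty,-T_L]\times\mathbb{R}^{2n+1})=(-\infty,-T_L]\times\Lambda_-$ and $L\cap([T_L,\infty)\times\mathbb{R}^{2n+1})=[T_L,\infty)\times\Lambda_+$, and such that $L\cap([-T_L-1,T_L+1]\times\mathbb{R}^{2n+1})$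 is compact. It is exact Lagrangian, written $\Lambda_-\prec^{ex}_L\Lambda_+$, if $L$ is Lagrangian for $d(e^t\alpha)$ and $e^t\alpha|_L=dh$ for some smooth function $h$ on $L$. *)

theory Defs
  imports "HOL-Analysis.Analysis"
begin

section \<open>Smooth maps and submanifolds of Euclidean spaces\<close>

text \<open>Meaningful for open \<open>S\<close> only: a map is \<open>C\<^sup>k\<^sup>+\<^sup>1\<close> iff it is differentiable and all its directional
  derivatives are \<open>C\<^sup>k\<close>.\<close>

primrec Ck_on :: "nat \<Rightarrow> 'a::euclidean_space set \<Rightarrow> ('a \<Rightarrow> 'b::real_normed_vector) \<Rightarrow> bool" where
  "Ck_on 0 S f \<longleftrightarrow> continuous_on S f"
| "Ck_on (Suc k) S f \<longleftrightarrow>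
     (\<forall>x\<in>S. f differentiable (at x)) \<and> (\<forall>v. Ck_on k S (\<lambda>x. frechet_derivative f (at x) v))"

text \<open>As usual for maps on an arbitrary subset of a Euclidean space, smoothness means that the map
  extends, locally around each point of the subset, to a \<open>C\<^sup>\<infinity>\<close> map on an open set.\<close>

definition smooth_on :: "'a::euclidean_space set \<Rightarrow> ('a \<Rightarrow> 'b::real_normed_vector) \<Rightarrow> bool" where
  "smooth_on S f \<longleftrightarrow>
     (\<forall>p\<in>S. \<exists>U g. open U \<and> p \<in> U \<and> (\<forall>k. Ck_on k U g) \<and> (\<forall>x\<in>S \<inter> U. g x = f x))"

definition diffeomorphism_betw ::
    "'a::euclidean_space set \<Rightarrow> 'b::euclidean_space set \<Rightarrow> ('a \<Rightarrow> 'b) \<Rightarrow> bool" where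
  "diffeomorphism_betw X Y f \<longleftrightarrow>
     bij_betw f X Y \<and> smooth_on X f \<and> smooth_on Y (inv_into X f)"

definition local_parametrization ::
    "'a::euclidean_space set \<Rightarrow> 'm::euclidean_space set \<Rightarrow> ('m \<Rightarrow> 'a) \<Rightarrow> bool" where
  "local_parametrization M W \<psi> \<longleftrightarrow>
     open W \<and> openin (top_of_set M) (\<psi> ` W) \<and> diffeomorphism_betw W (\<psi> ` W) \<psi>"

text \<open>Embedded submanifolds without boundary. The type \<open>'m\<close> of the model space carries the
  dimension, which is \<open>DIM('m)\<close>.\<close>

definition smooth_submanifold ::
    "'m::euclidean_space itself \<Rightarrow> 'a::euclidean_space set \<Rightarrow> bool" where
  "smooth_submanifold _ M \<longleftrightarrow>
     (\<forall>p\<in>M. \<exists>(W::'m set) \<psi>. local_parametrization M W \<psi> \<and> p \<in> \<psi> ` W)"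

definition orientable :: "(real^'m) itself \<Rightarrow> 'a::euclidean_space set \<Rightarrow> bool" where
  "orientable _ M \<longleftrightarrow>
     (\<exists>A :: ((real^'m) set \<times> (real^'m \<Rightarrow> 'a)) set.
        (\<forall>(W, \<psi>)\<in>A. local_parametrization M W \<psi>) \<and>
        M \<subseteq> (\<Union>(W, \<psi>)\<in>A. \<psi> ` W) \<and>
        (\<forall>(W1, \<psi>1)\<in>A. \<forall>(W2, \<psi>2)\<in>A. \<forall>w\<in>W1. \<psi>1 w \<in> \<psi>2 ` W2 \<longrightarrow>
           det (matrix (frechet_derivative (inv_into W2 \<psi>2 \<circ> \<psi>1) (at w))) > 0))"

definition curve_through ::
    "'a::euclidean_space set \<Rightarrow> 'a \<Rightarrow> 'a \<Rightarrow> (real \<Rightarrow> 'a) \<Rightarrow> bool" where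
  "curve_through M p v \<gamma> \<longleftrightarrow>
     (\<exists>\<epsilon>>0. smooth_on {-\<epsilon><..<\<epsilon>} \<gamma> \<and> \<gamma> ` {-\<epsilon><..<\<epsilon>} \<subseteq> M) \<and>
     \<gamma> 0 = p \<and> (\<gamma> has_vector_derivative v) (at 0)"

definition tangent_space :: "'a::euclidean_space set \<Rightarrow> 'a \<Rightarrow> 'a set" where
  "tangent_space M p = {v. \<exists>\<gamma>. curve_through M p v \<gamma>}"

text \<open>The differential at \<open>p\<close> of a smooth function \<open>f\<close> on \<open>M\<close>, evaluated at a tangent vector \<open>v\<close>;
  unspecified if \<open>v\<close> is not tangent to \<open>M\<close> at \<open>p\<close>.\<close>

definition differential_on ::
    "'a::euclidean_space set \<Rightarrow> ('a \<Rightarrow> 'b::real_normed_vector) \<Rightarrow> 'a \<Rightarrow> 'a \<Rightarrow> 'b" where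
  "differential_on M f p v =
     (THE w. \<forall>\<gamma>. curve_through M p v \<gamma> \<longrightarrow> ((f \<circ> \<gamma>) has_vector_derivative w) (at 0))"

text \<open>A 1-form is a function of a base point and a vector. The formula is
  \<open>d\<theta>(X, Y) = X(\<theta>(Y)) - Y(\<theta>(X)) - \<theta>([X, Y])\<close> for the constant, hence commuting, vector
  fields with values \<open>u\<close> and \<open>v\<close>.\<close>

definition exterior_derivative ::
    "('a::euclidean_space \<Rightarrow> 'a \<Rightarrow> real) \<Rightarrow> 'a \<Rightarrow> 'a \<Rightarrow> 'a \<Rightarrow> real" where
  "exterior_derivative \<theta> p u v =
     frechet_derivative (\<lambda>q. \<theta> q v) (at p) u - frechet_derivative (\<lambda>q. \<theta> q u) (at p) v"


section \<open>Legendrian submanifolds\<close>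

text \<open>\<open>\<real>\<^sup>2\<^sup>n\<^sup>+\<^sup>1\<close> with \<open>n = CARD('n) \<ge> 1\<close> and coordinates grouped as \<open>(x, y, z)\<close>.\<close>

type_synonym 'n contact_space = "(real^'n) \<times> (real^'n) \<times> real"

definition contact_form :: "'n::finite contact_space \<Rightarrow> 'n contact_space \<Rightarrow> real" where
  "contact_form = (\<lambda>(x, y, z) (dx, dy, dz). dz - (\<Sum>i\<in>UNIV. y $ i * dx $ i))"

definition contact_structure :: "'n::finite contact_space \<Rightarrow> 'n contact_space set" where
  "contact_structure p = {v. contact_form p v = 0}"

definition legendrian :: "'n::finite contact_space set \<Rightarrow> bool" where
  "legendrian \<Lambda> \<longleftrightarrow> smooth_submanifold TYPE(real^'n) \<Lambda> \<and>
     (\<forall>p\<in>\<Lambda>. tangent_space \<Lambda> p \<subseteq> contact_structure p)"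

definition lagrangian_projection :: "'n::finite contact_space \<Rightarrow> (real^'n) \<times> (real^'n)" where
  "lagrangian_projection = (\<lambda>(x, y, z). (x, y))"

text \<open>The projection is linear, so it is its own differential; transversality in \<open>\<real>\<^sup>2\<^sup>n\<close> says that the
  two projected tangent spaces together span.\<close>

definition chord_generic :: "'n::finite contact_space set \<Rightarrow> bool" where
  "chord_generic \<Lambda> \<longleftrightarrow>
     finite {c. \<exists>p\<in>\<Lambda>. \<exists>q\<in>\<Lambda>. p \<noteq> q \<and> lagrangian_projection p = c \<and> lagrangian_projection q = c} \<and>
     (\<forall>p\<in>\<Lambda>. \<forall>q\<in>\<Lambda>. p \<noteq> q \<and> lagrangian_projection p = lagrangian_projection q \<longrightarrow>
        {r\<in>\<Lambda>. lagrangian_projection r = lagrangian_projection p} = {p, q} \<and>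
        span (lagrangian_projection ` tangent_space \<Lambda> p \<union>
              lagrangian_projection ` tangent_space \<Lambda> q) = UNIV)"

definition legendrian_isotopic ::
    "'n::finite contact_space set \<Rightarrow> 'n contact_space set \<Rightarrow> bool" where
  "legendrian_isotopic \<Lambda>\<^sub>0 \<Lambda>\<^sub>1 \<longleftrightarrow>
     (\<exists>F :: real \<times> 'n contact_space \<Rightarrow> 'n contact_space.
        smooth_on ({0..1} \<times> \<Lambda>\<^sub>0) F \<and>
        (\<forall>s\<in>{0..1}. let \<Lambda>\<^sub>s = (\<lambda>p. F (s, p)) ` \<Lambda>\<^sub>0
           in legendrian \<Lambda>\<^sub>s \<and> diffeomorphism_betw \<Lambda>\<^sub>0 \<Lambda>\<^sub>s (\<lambda>p. F (s, p))) \<and>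
        (\<forall>p\<in>\<Lambda>\<^sub>0. F (0, p) = p) \<and>
        (\<lambda>p. F (1, p)) ` \<Lambda>\<^sub>0 = \<Lambda>\<^sub>1)"


section \<open>Lagrangian cobordisms in the symplectization\<close>

text \<open>The 1-form \<open>e\<^sup>t \<alpha>\<close>.\<close>

definition liouville_form ::
    "real \<times> 'n::finite contact_space \<Rightarrow> real \<times> 'n contact_space \<Rightarrow> real" where
  "liouville_form = (\<lambda>(t, p) (dt, v). exp t * contact_form p v)"

definition symplectic_form ::
    "real \<times> 'n::finite contact_space \<Rightarrow> real \<times> 'n contact_space \<Rightarrow> real \<times> 'n contact_space \<Rightarrow> real"
  where "symplectic_form = exterior_derivative liouville_form"

text \<open>\<open>L\<close> includes its infinite cylindrical ends; cutting it off at \<open>t = \<plusminus>T\<close> gives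
  a compact cobordism with boundary \<open>{-T} \<times> \<Lambda>\<^sub>-\<close> and \<open>{T} \<times> \<Lambda>\<^sub>+\<close>.\<close>

definition embedded_cobordism ::
    "(real \<times> 'n::finite contact_space) set \<Rightarrow> 'n contact_space set \<Rightarrow> 'n contact_space set \<Rightarrow> bool"
  where
  "embedded_cobordism L \<Lambda>\<^sub>m \<Lambda>\<^sub>p \<longleftrightarrow> smooth_submanifold TYPE(real \<times> (real^'n)) L \<and>
     (\<exists>T>0. L \<inter> ({..-T} \<times> UNIV) = {..-T} \<times> \<Lambda>\<^sub>m \<and>
            L \<inter> ({T..} \<times> UNIV) = {T..} \<times> \<Lambda>\<^sub>p \<and>
            compact (L \<inter> ({-T-1..T+1} \<times> UNIV)))"

definition lagrangian :: "(real \<times> 'n::finite contact_space) set \<Rightarrow> bool" where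
  "lagrangian L \<longleftrightarrow> smooth_submanifold TYPE(real \<times> (real^'n)) L \<and>
     (\<forall>p\<in>L. \<forall>u\<in>tangent_space L p. \<forall>v\<in>tangent_space L p. symplectic_form p u v = 0)"

definition exact_lagrangian :: "(real \<times> 'n::finite contact_space) set \<Rightarrow> bool" where
  "exact_lagrangian L \<longleftrightarrow> lagrangian L \<and>
     (\<exists>h :: real \<times> 'n contact_space \<Rightarrow> real. smooth_on L h \<and>
        (\<forall>p\<in>L. \<forall>v\<in>tangent_space L p. liouville_form p v = differential_on L h p v))"

definition exact_lagrangian_cobordism ::
    "'n::finite contact_space set \<Rightarrow> (real \<times> 'n contact_space) set \<Rightarrow> 'n contact_space set \<Rightarrow> bool"
    (\<open>_ \<prec>\<^sup>e\<^sup>x\<^bsub>_\<^esub> _\<close> [51, 0, 51] 50) where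
  "\<Lambda>\<^sub>m \<prec>\<^sup>e\<^sup>x\<^bsub>L\<^esub> \<Lambda>\<^sub>p \<longleftrightarrow> embedded_cobordism L \<Lambda>\<^sub>m \<Lambda>\<^sub>p \<and> exact_lagrangian L"

end

theory Submission
  imports Defs
begin

text \<open>
  Let \<open>F(s, \<cdot>)\<close>, \<open>0 \<le> s \<le> 1\<close>, be a Legendrian isotopy from \<open>\<Lambda>\<^sub>m\<close> to \<open>\<Lambda>\<^sub>p\<close>, let
  \<open>H(s, p) = \<alpha>(\<partial>\<^sub>s F(s, p))\<close>, and let \<open>s(t)\<close> be a smooth step from \<open>0\<close> to \<open>1\<close>. The trace
  \<open>(t, p) \<mapsto> (t, F(s(t), p))\<close> has the right ends but is not Lagrangian in general: since every slice is
  Legendrian, \<open>e\<^sup>t \<alpha>\<close> pulls back to \<open>e\<^sup>t g dt\<close> with \<open>g(t, p) = s'(t) H(s(t), p)\<close>. Shifting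
  the point over \<open>(t, p)\<close> by \<open>g\<close> in the \<open>z\<close>-direction adds \<open>e\<^sup>t dg\<close>, because
  \<open>\<alpha> = dz - y dx\<close> has coefficients independent of \<open>z\<close>. The pullback becomes
  \<open>e\<^sup>t (g dt + dg) = d(e\<^sup>t g)\<close>, so the shifted trace
  \<open>\<Phi>(t, p) = (t, F(s(t), p) + (0, 0, g(t, p)))\<close> is exact with primitive \<open>e\<^sup>t g\<close>
  (lemma \<open>liouville_form_on_trace\<close>), and it is still cylindrical where \<open>s' = 0\<close>. Exactness
  gives the Lagrangian condition by \<open>d \<circ> d = 0\<close> (lemma \<open>exact_form_is_closed\<close>), which rests on
  the symmetry of second derivatives.

  It remains to see that the image of \<open>\<Phi>\<close> is an embedded submanifold. By compactness there is one
  \<open>m > 0\<close> with \<open>dist (F(s, p)) (F(s, q)) \<ge> m dist p q\<close> for all \<open>s\<close> (lemma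
  \<open>uniform_lower_bound_of_embeddings\<close>). If the step is so slow that the shift has Lipschitz constant
  at most \<open>m / 2\<close> in \<open>p\<close>, then \<open>\<Phi>\<close> shrinks no distance by more than a fixed factor (lemma
  \<open>smooth_trace_lower_bound\<close>). A smooth map with such a lower bound is injective, immersive and a
  homeomorphism onto its image all at once, hence a diffeomorphism onto its image by the smooth inverse
  function theorem (lemma \<open>diffeomorphism_of_lower_bound\<close>).\<close>

section \<open>Calculus of \<open>C\<^sup>k\<close> maps on open sets\<close>

lemma Ck_on_subset: "Ck_on k S f \<Longrightarrow> T \<subseteq> S \<Longrightarrow> Ck_on k T f"
proof (induction k arbitrary: f)
  case 0
  then show ?case by (auto intro: continuous_on_subset)
next
  case (Suc k)
  then show ?case by auto
qed

lemma Ck_on_has_derivative: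
  assumes "Ck_on (Suc k) S f" "x \<in> S"
  shows "(f has_derivative frechet_derivative f (at x)) (at x)"
  using assms by (simp add: frechet_derivative_works)

lemma Ck_on_cong_open:
  assumes "open S" "\<And>x. x \<in> S \<Longrightarrow> f x = g x" "Ck_on k S f"
  shows "Ck_on k S g"
  using assms(2,3)
proof (induction k arbitrary: f g)
  case 0
  then show ?case by (simp cong: continuous_on_cong)
next
  case (Suc k)
  have der: "(g has_derivative frechet_derivative f (at x)) (at x)" if "x \<in> S" for x
    using Ck_on_has_derivative[OF Suc.prems(2) that] assms(1) that Suc.prems(1)
    by (rule has_derivative_transform_within_open)
  then have eq: "frechet_derivative f (at x) = frechet_derivative g (at x)" if "x \<in> S" for x
    using that frechet_derivative_at by blast
  have "Ck_on k S (\<lambda>x. frechet_derivative g (at x) v)" for v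
    using Suc.IH[of "\<lambda>x. frechet_derivative f (at x) v" "\<lambda>x. frechet_derivative g (at x) v"]
      Suc.prems(2) eq by auto
  with der show ?case by (auto simp: differentiable_def)
qed

text \<open>The working form of the recursive clause: it lets the closure properties below be proved by
  induction on \<open>k\<close> from the matching rule for \<open>has_derivative\<close>, with the derivative in
  whatever shape that rule produces.\<close>

lemma Ck_on_SucI:
  assumes "open S" "\<And>x. x \<in> S \<Longrightarrow> (f has_derivative f' x) (at x)"
    and "\<And>v. Ck_on k S (\<lambda>x. f' x v)"
  shows "Ck_on (Suc k) S f"
proof -
  have *: "frechet_derivative f (at x) = f' x" if "x \<in> S" for x
    using frechet_derivative_at[OF assms(2)[OF that]] by simp
  have "Ck_on k S (\<lambda>x. frechet_derivative f (at x) v)" for v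
    by (rule Ck_on_cong_open[OF assms(1) _ assms(3)[of v]]) (simp add: *)
  with assms(2) show ?thesis by (auto simp: differentiable_def)
qed

lemma Ck_on_SucD: "Ck_on (Suc k) S f \<Longrightarrow> Ck_on k S f"
proof (induction k arbitrary: f)
  case 0
  then show ?case
    by (auto intro!: differentiable_imp_continuous_on differentiable_at_imp_differentiable_on)
next
  case (Suc k)
  then have "Ck_on k S (\<lambda>x. frechet_derivative f (at x) v)" for v
    using Suc.IH[of "\<lambda>x. frechet_derivative f (at x) v"] Suc.prems by simp
  then show ?case using Suc.prems by auto
qed

lemma Ck_on_local:
  assumes "\<And>x. x \<in> S \<Longrightarrow> \<exists>U. open U \<and> x \<in> U \<and> Ck_on k U f"
  shows "Ck_on k S f"
  using assms
proof (induction k arbitrary: f)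
  case 0
  have "isCont f x" if "x \<in> S" for x
    using 0[OF that] by (auto simp: continuous_on_eq_continuous_at)
  then show ?case by (simp add: continuous_at_imp_continuous_on)
next
  case (Suc k)
  have "f differentiable at x" if "x \<in> S" for x
    using Suc.prems[OF that] by auto
  moreover have "Ck_on k S (\<lambda>x. frechet_derivative f (at x) v)" for v
    by (rule Suc.IH) (use Suc.prems in fastforce)
  ultimately show ?case by simp
qed

lemma Ck_on_const: "open S \<Longrightarrow> Ck_on k S (\<lambda>x. c)"
  by (induction k arbitrary: c) (auto intro!: continuous_intros)

lemma Ck_on_bounded_linear:
  assumes "open S" "bounded_linear f"
  shows "Ck_on k S f"
proof (cases k)
  case 0
  then show ?thesis using assms by (auto intro: linear_continuous_on)
next
  case (Suc l)
  show ?thesis unfolding Suc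
    by (rule Ck_on_SucI[where f' = "\<lambda>_. f"])
      (use assms in \<open>auto intro: bounded_linear_imp_has_derivative Ck_on_const\<close>)
qed

lemma Ck_on_linear_compose:
  assumes "bounded_linear l" "open S" "Ck_on k S f"
  shows "Ck_on k S (\<lambda>x. l (f x))"
  using assms(3)
proof (induction k arbitrary: f)
  case 0
  then show ?case using assms by (auto intro: bounded_linear.continuous_on)
next
  case (Suc k)
  show ?case
    by (rule Ck_on_SucI[OF assms(2) bounded_linear.has_derivative[OF assms(1)
            Ck_on_has_derivative[OF Suc.prems]]])
      (use Suc in auto)
qed

lemma Ck_on_add:
  assumes "open S" "Ck_on k S f" "Ck_on k S g"
  shows "Ck_on k S (\<lambda>x. f x + g x)"
  using assms(2,3)
proof (induction k arbitrary: f g)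
  case 0
  then show ?case by (auto intro: continuous_on_add)
next
  case (Suc k)
  show ?case
    by (rule Ck_on_SucI[OF assms(1) has_derivative_add[OF Ck_on_has_derivative[OF Suc.prems(1)]
            Ck_on_has_derivative[OF Suc.prems(2)]]])
      (use Suc in auto)
qed

lemma Ck_on_sum:
  assumes "open S" "\<And>i. i \<in> I \<Longrightarrow> Ck_on k S (f i)"
  shows "Ck_on k S (\<lambda>x. \<Sum>i\<in>I. f i x)"
  using assms(2)
proof (induction I rule: infinite_finite_induct)
  case (insert i I)
  have "Ck_on k S (\<lambda>x. f i x + (\<Sum>i\<in>I. f i x))"
    by (rule Ck_on_add[OF assms(1)]) (use insert in auto)
  with insert.hyps show ?case by simp
qed (simp_all add: Ck_on_const assms(1))

lemma Ck_on_bilinear: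
  assumes "bounded_bilinear b" "open S" "Ck_on k S f" "Ck_on k S g"
  shows "Ck_on k S (\<lambda>x. b (f x) (g x))"
  using assms(3,4)
proof (induction k arbitrary: f g)
  case 0
  then show ?case by (auto intro: bounded_bilinear.continuous_on[OF assms(1)])
next
  case (Suc k)
  note lower = Ck_on_SucD[OF Suc.prems(1)] Ck_on_SucD[OF Suc.prems(2)]
  show ?case
    by (rule Ck_on_SucI[OF assms(2) bounded_bilinear.FDERIV[OF assms(1)
            Ck_on_has_derivative[OF Suc.prems(1)] Ck_on_has_derivative[OF Suc.prems(2)]]])
      (use Suc lower in \<open>auto intro!: Ck_on_add assms(2)\<close>)
qed

lemma linear_basis_expansion:
  fixes l :: "'a::euclidean_space \<Rightarrow> 'b::real_vector"
  assumes "linear l"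
  shows "l v = (\<Sum>b\<in>Basis. (v \<bullet> b) *\<^sub>R l b)"
proof -
  have "l v = l (\<Sum>b\<in>Basis. (v \<bullet> b) *\<^sub>R b)" by (simp add: euclidean_representation)
  also have "\<dots> = (\<Sum>b\<in>Basis. (v \<bullet> b) *\<^sub>R l b)"
    by (simp add: linear_sum[OF assms] linear_scale[OF assms])
  finally show ?thesis .
qed

text \<open>The derivative \<open>Dg(f x)(Df(x) v)\<close> depends on \<open>x\<close> both through the base point and
  through the direction, whereas \<open>C\<^sup>k\<close> only speaks of fixed directions. Expanding the
  direction in a basis separates the two and leaves products of maps covered by the induction
  hypothesis.\<close>

lemma Ck_on_compose:
  fixes f :: "'a::euclidean_space \<Rightarrow> 'b::euclidean_space" and g :: "'b \<Rightarrow> 'c::real_normed_vector"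
  assumes "open S" "open T" "f ` S \<subseteq> T" "Ck_on k S f" "Ck_on k T g"
  shows "Ck_on k S (\<lambda>x. g (f x))"
  using assms(4,5)
proof (induction k arbitrary: g)
  case 0
  then show ?case using assms(3) by (auto intro: continuous_on_compose2)
next
  case (Suc k)
  let ?Df = "\<lambda>x. frechet_derivative f (at x)" and ?Dg = "\<lambda>y. frechet_derivative g (at y)"
  show ?case
  proof (rule Ck_on_SucI[OF assms(1)])
    fix x assume "x \<in> S"
    then have f: "(f has_derivative ?Df x) (at x)" and g: "(g has_derivative ?Dg (f x)) (at (f x))"
      using Suc.prems Ck_on_has_derivative assms(3) by blast+
    have "((\<lambda>x. g (f x)) has_derivative (\<lambda>v. ?Dg (f x) (?Df x v))) (at x)"
      by (rule has_derivative_compose[OF f g])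
    also have "(\<lambda>v. ?Dg (f x) (?Df x v)) = (\<lambda>v. \<Sum>b\<in>Basis. (?Df x v \<bullet> b) *\<^sub>R ?Dg (f x) b)"
      by (rule ext, rule linear_basis_expansion[OF has_derivative_linear[OF g]])
    finally show "((\<lambda>x. g (f x)) has_derivative
        (\<lambda>v. \<Sum>b\<in>Basis. (?Df x v \<bullet> b) *\<^sub>R ?Dg (f x) b)) (at x)" .
  next
    fix v
    show "Ck_on k S (\<lambda>x. \<Sum>b\<in>Basis. (?Df x v \<bullet> b) *\<^sub>R ?Dg (f x) b)"
    proof (rule Ck_on_sum[OF assms(1)])
      fix b :: 'b
      have "Ck_on k S (\<lambda>x. ?Df x v \<bullet> b)"
        by (rule Ck_on_linear_compose[OF bounded_linear_inner_left assms(1)]) (use Suc in auto)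
      moreover have "Ck_on k S (\<lambda>x. ?Dg (f x) b)"
        using Suc.IH[of "\<lambda>y. ?Dg y b"] Ck_on_SucD[OF Suc.prems(1)] Suc.prems(2) by auto
      ultimately show "Ck_on k S (\<lambda>x. (?Df x v \<bullet> b) *\<^sub>R ?Dg (f x) b)"
        by (rule Ck_on_bilinear[OF bounded_bilinear_scaleR assms(1)])
    qed
  qed
qed

lemma Ck_on_Pair:
  assumes "open S" "Ck_on k S f" "Ck_on k S g"
  shows "Ck_on k S (\<lambda>x. (f x, g x))"
  using assms(2,3)
proof (induction k arbitrary: f g)
  case 0
  then show ?case by (auto intro: continuous_on_Pair)
next
  case (Suc k)
  show ?case
    by (rule Ck_on_SucI[OF assms(1) has_derivative_Pair[OF Ck_on_has_derivative[OF Suc.prems(1)]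
            Ck_on_has_derivative[OF Suc.prems(2)]]])
      (use Suc in auto)
qed

lemma Ck_on_inverse: "Ck_on k {x::real. x \<noteq> 0} inverse"
proof (induction k)
  case 0
  show ?case by (auto intro!: continuous_intros)
next
  case (Suc k)
  have o: "open {x::real. x \<noteq> 0}" by (simp add: open_Collect_neq)
  show ?case
  proof (rule Ck_on_SucI[OF o])
    show "(inverse has_derivative (\<lambda>v. - (inverse x * v * inverse x))) (at x)"
      if "x \<in> {x. x \<noteq> 0}" for x :: real
      using that has_derivative_inverse' by blast
    fix v :: real
    have "Ck_on k {x. x \<noteq> 0} (\<lambda>x::real. (- v) * (inverse x * inverse x))"
      using Ck_on_linear_compose[where l = "\<lambda>z. (- v) * z", OF bounded_linear_mult_right o
          Ck_on_bilinear[OF bounded_bilinear_mult o Suc.IH Suc.IH]] .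
    moreover have "(\<lambda>x::real. (- v) * (inverse x * inverse x)) = (\<lambda>x. - (inverse x * v * inverse x))"
      by (simp add: fun_eq_iff)
    ultimately show "Ck_on k {x. x \<noteq> 0} (\<lambda>x::real. - (inverse x * v * inverse x))"
      by simp
  qed
qed

lemma Ck_on_exp: "Ck_on k UNIV (exp :: real \<Rightarrow> real)"
proof (induction k)
  case 0
  show ?case by (auto intro!: continuous_intros)
next
  case (Suc k)
  have "Ck_on k UNIV (\<lambda>x::real. exp x * v)" for v
    using Ck_on_linear_compose[where l = "\<lambda>z. z * v", OF bounded_linear_mult_left open_UNIV Suc.IH] .
  then show ?case
    by (rule Ck_on_SucI[where f' = "\<lambda>x v. exp x * v", OF open_UNIV, rotated])
      (rule DERIV_exp[unfolded has_field_derivative_def])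
qed

section \<open>Strict differentiability and symmetry of second derivatives\<close>

lemma derivative_near_basepoint:
  fixes f :: "'a::euclidean_space \<Rightarrow> 'b::real_normed_vector"
  assumes "open U" "Ck_on (Suc 0) U f" "x0 \<in> U" "\<epsilon> > 0"
  obtains r where "r > 0" "ball x0 r \<subseteq> U"
    "\<And>x v. x \<in> ball x0 r \<Longrightarrow>
      norm (frechet_derivative f (at x) v - frechet_derivative f (at x0) v) \<le> \<epsilon> * norm v"
proof -
  let ?D = "\<lambda>x. frechet_derivative f (at x)"
  let ?g = "\<lambda>x. \<Sum>b\<in>Basis. norm (?D x b - ?D x0 b)"
  have lin: "linear (?D x)" if "x \<in> U" for x
    using has_derivative_linear[OF Ck_on_has_derivative[OF assms(2) that]] .
  have "continuous_on U ?g"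
    using assms(2) by (auto intro!: continuous_intros)
  then have "isCont ?g x0"
    using assms(1,3) continuous_on_eq_continuous_at by blast
  then have "\<exists>d>0. \<forall>x. dist x x0 < d \<longrightarrow> dist (?g x) (?g x0) < \<epsilon>"
    using assms(4) unfolding continuous_at_eps_delta by blast
  then obtain d where d: "d > 0" "\<And>x. dist x x0 < d \<Longrightarrow> dist (?g x) (?g x0) < \<epsilon>" by blast
  obtain e where e: "e > 0" "ball x0 e \<subseteq> U" using assms(1,3) openE by blast
  show ?thesis
  proof (rule that[of "min d e"])
    show "min d e > 0" "ball x0 (min d e) \<subseteq> U" using d e by auto
    fix x v assume x: "x \<in> ball x0 (min d e)"
    then have xU: "x \<in> U" using e by auto
    have "dist x x0 < d" using x by (simp add: dist_commute)
    from d(2)[OF this] have g: "?g x < \<epsilon>" by (simp add: dist_real_def)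
    have "?D x v - ?D x0 v = (\<Sum>b\<in>Basis. (v \<bullet> b) *\<^sub>R (?D x b - ?D x0 b))"
      using linear_basis_expansion[OF lin[OF xU], of v] linear_basis_expansion[OF lin[OF assms(3)], of v]
      by (simp add: scaleR_diff_right sum_subtractf)
    also have "norm \<dots> \<le> (\<Sum>b\<in>Basis. norm v * norm (?D x b - ?D x0 b))"
      by (rule sum_norm_le) (simp add: mult_right_mono Basis_le_norm)
    also have "\<dots> = norm v * ?g x" by (simp add: sum_distrib_left)
    also have "\<dots> \<le> norm v * \<epsilon>" by (rule mult_left_mono) (use g in auto)
    finally show "norm (?D x v - ?D x0 v) \<le> \<epsilon> * norm v" by (simp add: mult.commute)
  qed
qed

text \<open>The mean value inequality applied to \<open>f - Df(x\<^sub>0)\<close> on a ball where the derivative has moved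
  by at most \<open>\<epsilon>\<close>. Differences at two nearby points are thus governed by one linear map; the
  local Lipschitz and lower bounds below come from this.\<close>

lemma strictly_differentiable:
  fixes f :: "'a::euclidean_space \<Rightarrow> 'b::real_normed_vector"
  assumes "open U" "Ck_on (Suc 0) U f" "x0 \<in> U" "\<epsilon> > 0"
  obtains r where "r > 0" "ball x0 r \<subseteq> U"
    "\<And>x y. x \<in> ball x0 r \<Longrightarrow> y \<in> ball x0 r \<Longrightarrow>
      norm (f x - f y - frechet_derivative f (at x0) (x - y)) \<le> \<epsilon> * norm (x - y)"
proof -
  let ?D = "\<lambda>x. frechet_derivative f (at x)"
  obtain r where r: "r > 0" "ball x0 r \<subseteq> U"
    "\<And>x v. x \<in> ball x0 r \<Longrightarrow> norm (?D x v - ?D x0 v) \<le> \<epsilon> * norm v"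
    using derivative_near_basepoint[OF assms] by blast
  have D: "(f has_derivative ?D x) (at x)" if "x \<in> U" for x
    using Ck_on_has_derivative[OF assms(2) that] .
  show ?thesis
  proof (rule that[OF r(1,2)])
    fix x y assume xy: "x \<in> ball x0 r" "y \<in> ball x0 r"
    have "norm ((f x - ?D x0 x) - (f y - ?D x0 y)) \<le> \<epsilon> * norm (x - y)"
    proof (rule differentiable_bound[where S = "ball x0 r" and f' = "\<lambda>z v. ?D z v - ?D x0 v"])
      fix z assume z: "z \<in> ball x0 r"
      then have "z \<in> U" using r(2) by auto
      then show "((\<lambda>x. f x - ?D x0 x) has_derivative (\<lambda>v. ?D z v - ?D x0 v)) (at z within ball x0 r)"
        by (intro has_derivative_diff has_derivative_at_withinI[OF D]
            bounded_linear_imp_has_derivative has_derivative_bounded_linear[OF D] assms(3))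
      show "onorm (\<lambda>v. ?D z v - ?D x0 v) \<le> \<epsilon>"
        by (rule onorm_le) (rule r(3)[OF z])
    qed (use xy in auto)
    moreover have "f x - f y - ?D x0 (x - y) = (f x - ?D x0 x) - (f y - ?D x0 y)"
      by (simp add: linear_diff[OF has_derivative_linear[OF D[OF assms(3)]]])
    ultimately show "norm (f x - f y - ?D x0 (x - y)) \<le> \<epsilon> * norm (x - y)"
      by metis
  qed
qed

text \<open>The second difference \<open>\<Delta> u v h\<close> is symmetric in \<open>u\<close> and \<open>v\<close>. Read as an increment in
  direction \<open>v\<close> of an increment in direction \<open>u\<close>, it equals \<open>h\<^sup>2\<close> times one of the
  mixed derivatives up to \<open>\<epsilon> h\<^sup>2\<close>; read the other way round it gives the other one.\<close>

lemma symmetric_second_derivative: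
  fixes f :: "'a::euclidean_space \<Rightarrow> 'b::real_normed_vector"
  assumes U: "open U" and f: "Ck_on (Suc (Suc 0)) U f" and x: "x \<in> U"
  shows "frechet_derivative (\<lambda>y. frechet_derivative f (at y) v) (at x) u =
         frechet_derivative (\<lambda>y. frechet_derivative f (at y) u) (at x) v"
proof -
  let ?D = "\<lambda>v y. frechet_derivative f (at y) v"
  let ?DD = "\<lambda>v u. frechet_derivative (?D v) (at x) u"
  define \<Delta> where "\<Delta> u v h = f (x + h *\<^sub>R u + h *\<^sub>R v) - f (x + h *\<^sub>R u) - f (x + h *\<^sub>R v) + f x"
    for u v and h :: real
  have D: "(f has_derivative (\<lambda>v. ?D v y)) (at y)" if "y \<in> U" for y
    using Ck_on_has_derivative[OF f that] .
  have key: "\<exists>d>0. \<forall>h. 0 < h \<and> h < d \<longrightarrow>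
      norm (\<Delta> u v h - (h * h) *\<^sub>R ?DD v u) \<le> \<epsilon> * (h * h) * norm u" if e: "\<epsilon> > 0" for \<epsilon> u v
  proof -
    have Dv: "Ck_on (Suc 0) U (?D v)" using f by simp
    have lin: "linear (?DD v)"
      using has_derivative_linear[OF Ck_on_has_derivative[OF Dv x]] .
    obtain r where r: "r > 0" "ball x r \<subseteq> U"
      "\<And>y z. y \<in> ball x r \<Longrightarrow> z \<in> ball x r \<Longrightarrow>
        norm (?D v y - ?D v z - ?DD v (y - z)) \<le> \<epsilon> * norm (y - z)"
      using strictly_differentiable[OF U Dv x e] by blast
    let ?d = "r / (norm u + norm v + 1)"
    have d0: "?d > 0" using r(1) by (simp add: add_nonneg_pos)
    have "norm (\<Delta> u v h - (h * h) *\<^sub>R ?DD v u) \<le> \<epsilon> * (h * h) * norm u"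
      if h: "0 < h" "h < ?d" for h
    proof -
      have "h * (norm u + norm v + 1) < r"
        using h(2) by (simp add: pos_less_divide_eq add_nonneg_pos)
      then have hr: "h * norm u + h * norm v < r" using h(1) by (simp add: algebra_simps)
      have in1: "x + t *\<^sub>R v \<in> ball x r" and in2: "x + h *\<^sub>R u + t *\<^sub>R v \<in> ball x r"
        if "t \<in> {0..h}" for t
      proof -
        have t: "t * norm v \<le> h * norm v" using that by (simp add: mult_right_mono)
        have "0 \<le> h * norm u" using h by simp
        then have "t * norm v < r" using t hr by linarith
        then show "x + t *\<^sub>R v \<in> ball x r" using that by (simp add: dist_norm)
        have "norm (h *\<^sub>R u + t *\<^sub>R v) \<le> h * norm u + t * norm v"
          using norm_triangle_ineq[of "h *\<^sub>R u" "t *\<^sub>R v"] that h by simp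
        moreover have "dist x (x + h *\<^sub>R u + t *\<^sub>R v) = norm (h *\<^sub>R u + t *\<^sub>R v)"
          by (metis add.assoc add_diff_cancel_left' dist_commute dist_norm)
        ultimately show "x + h *\<^sub>R u + t *\<^sub>R v \<in> ball x r"
          using t hr by simp
      qed
      \<comment> \<open>the increment in direction \<open>u\<close>, corrected by its expected linear growth in direction \<open>v\<close>\<close>
      let ?\<phi> = "\<lambda>t. f (x + h *\<^sub>R u + t *\<^sub>R v) - f (x + t *\<^sub>R v) - t *\<^sub>R (h *\<^sub>R ?DD v u)"
      let ?\<phi>' = "\<lambda>t. ?D v (x + h *\<^sub>R u + t *\<^sub>R v) - ?D v (x + t *\<^sub>R v) - h *\<^sub>R ?DD v u"
      have "norm (?\<phi> h - ?\<phi> 0) \<le> (\<epsilon> * (h * norm u)) * norm (h - 0)"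
      proof (rule differentiable_bound[where S = "{0..h}" and f' = "\<lambda>t s. s *\<^sub>R ?\<phi>' t"])
        fix t assume t: "t \<in> {0..h}"
        have *: "((\<lambda>t. f (c + t *\<^sub>R v)) has_derivative (\<lambda>s. s *\<^sub>R ?D v (c + t *\<^sub>R v))) (at t within {0..h})"
          if "c + t *\<^sub>R v \<in> U" for c
        proof -
          have 1: "((\<lambda>t. c + t *\<^sub>R v) has_derivative (\<lambda>s. s *\<^sub>R v)) (at t within {0..h})"
            by (auto intro!: derivative_eq_intros)
          have "((\<lambda>t. f (c + t *\<^sub>R v)) has_derivative (\<lambda>s. ?D (s *\<^sub>R v) (c + t *\<^sub>R v))) (at t within {0..h})"
            using has_derivative_compose[OF 1 D[OF that]] .
          moreover have "?D (s *\<^sub>R v) (c + t *\<^sub>R v) = s *\<^sub>R ?D v (c + t *\<^sub>R v)" for s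
            using linear_scale[OF has_derivative_linear[OF D[OF that]]] .
          ultimately show ?thesis by simp
        qed
        have "x + t *\<^sub>R v \<in> U" "x + h *\<^sub>R u + t *\<^sub>R v \<in> U"
          using in1[OF t] in2[OF t] r(2) by auto
        note d = has_derivative_diff[OF has_derivative_diff[OF *[OF this(2)] *[OF this(1)]]
            bounded_linear_imp_has_derivative[OF bounded_linear_scaleR_left[of "h *\<^sub>R ?DD v u"]]]
        show "(?\<phi> has_derivative (\<lambda>s. s *\<^sub>R ?\<phi>' t)) (at t within {0..h})"
          using d by (simp add: scaleR_diff_right)
        have "norm (?\<phi>' t) \<le> \<epsilon> * norm ((x + h *\<^sub>R u + t *\<^sub>R v) - (x + t *\<^sub>R v))"
          using r(3)[OF in2[OF t] in1[OF t]] by (simp add: linear_scale[OF lin])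
        then have "norm (?\<phi>' t) \<le> \<epsilon> * (h * norm u)" using h by simp
        then show "onorm (\<lambda>s. s *\<^sub>R ?\<phi>' t) \<le> \<epsilon> * (h * norm u)"
          by (intro onorm_le) (simp add: mult.commute mult_left_mono)
      qed (use h in auto)
      then show ?thesis
        using h by (simp add: \<Delta>_def algebra_simps)
    qed
    with d0 show ?thesis by blast
  qed
  have comm: "\<Delta> u v h = \<Delta> v u h" for h by (simp add: \<Delta>_def algebra_simps)
  have "norm (?DD v u - ?DD u v) \<le> \<epsilon> * (norm u + norm v)" if e: "\<epsilon> > 0" for \<epsilon>
  proof -
    obtain d1 d2 where d: "d1 > 0" "d2 > 0"
      "\<And>h. 0 < h \<Longrightarrow> h < d1 \<Longrightarrow> norm (\<Delta> u v h - (h * h) *\<^sub>R ?DD v u) \<le> \<epsilon> * (h * h) * norm u"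
      "\<And>h. 0 < h \<Longrightarrow> h < d2 \<Longrightarrow> norm (\<Delta> v u h - (h * h) *\<^sub>R ?DD u v) \<le> \<epsilon> * (h * h) * norm v"
      using key[OF e, of u v] key[OF e, of v u] by auto
    define h where "h = min d1 d2 / 2"
    have h: "0 < h" "h < d1" "h < d2" using d(1,2) by (auto simp: h_def)
    have "(h * h) * norm (?DD v u - ?DD u v) = norm ((h * h) *\<^sub>R (?DD v u - ?DD u v))"
      by simp
    also have "\<dots> = norm ((\<Delta> v u h - (h * h) *\<^sub>R ?DD u v) - (\<Delta> u v h - (h * h) *\<^sub>R ?DD v u))"
      by (simp add: comm algebra_simps)
    also have "\<dots> \<le> \<epsilon> * (h * h) * norm v + \<epsilon> * (h * h) * norm u"
      using norm_triangle_ineq4 d(3)[OF h(1,2)] d(4)[OF h(1,3)] by (meson add_mono order_trans)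
    also have "\<dots> = (h * h) * (\<epsilon> * (norm u + norm v))" by (simp add: algebra_simps)
    finally show ?thesis using h(1) by simp
  qed
  then have *: "norm (?DD v u - ?DD u v) \<le> \<epsilon> * (norm u + norm v)" if "\<epsilon> > 0" for \<epsilon> using that .
  have "norm (?DD v u - ?DD u v) \<le> 0 + e" if "e > 0" for e
  proof -
    let ?n = "norm u + norm v + 1"
    have n: "?n > 0" by (simp add: add_nonneg_pos)
    have "norm (?DD v u - ?DD u v) \<le> e / ?n * (norm u + norm v)" using *[of "e / ?n"] that n by simp
    also have "\<dots> \<le> e / ?n * ?n" using that n by (intro mult_left_mono) auto
    finally show ?thesis using n by simp
  qed
  then have "norm (?DD v u - ?DD u v) \<le> 0" by (rule field_le_epsilon)
  then show ?thesis by simp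
qed

section \<open>The smooth inverse function theorem\<close>

text \<open>A direction killed by the derivative would be one along which \<open>f\<close> changes by \<open>o(t)\<close> only,
  against the linear lower bound.\<close>

lemma inj_derivative_of_lower_bound:
  fixes f :: "'a::real_normed_vector \<Rightarrow> 'b::real_normed_vector"
  assumes f: "(f has_derivative f') (at x)" and "open U" "x \<in> U" "m > 0"
    and low: "\<And>y. y \<in> U \<Longrightarrow> m * dist y x \<le> dist (f y) (f x)"
  shows "inj f'"
proof -
  have lin: "linear f'" using f by (rule has_derivative_linear)
  have "\<forall>e>0. \<exists>d>0. \<forall>y. norm (y - x) < d \<longrightarrow> norm (f y - f x - f' (y - x)) \<le> e * norm (y - x)"
    using f unfolding has_derivative_at_alt by blast
  then obtain d where d: "d > 0"
    "\<And>y. norm (y - x) < d \<Longrightarrow> norm (f y - f x - f' (y - x)) \<le> m / 2 * norm (y - x)"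
    using assms(4) half_gt_zero by blast
  obtain e where e: "e > 0" "ball x e \<subseteq> U" using assms(2,3) openE by blast
  have "v = 0" if v: "f' v = 0" for v
  proof (rule ccontr)
    assume "v \<noteq> 0"
    define t where "t = min d e / (2 * norm v)"
    have t: "t > 0" using d e \<open>v \<noteq> 0\<close> by (simp add: t_def)
    have n: "norm (t *\<^sub>R v) = min d e / 2" using \<open>v \<noteq> 0\<close> d e by (simp add: t_def)
    let ?y = "x + t *\<^sub>R v"
    have "?y \<in> U" using n d(1) e by (intro subsetD[OF e(2)]) (simp add: dist_norm)
    then have "m * norm (t *\<^sub>R v) \<le> norm (f ?y - f x)"
      using low[of ?y] by (simp add: dist_norm)
    also have "\<dots> \<le> m / 2 * norm (t *\<^sub>R v)"
      using d(2)[of ?y] n d(1) e(1) v linear_scale[OF lin, of t v] by simp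
    finally show False using n d e assms(4) by simp
  qed
  then show ?thesis using linear_injective_0[OF lin] by blast
qed

text \<open>A product rule in which one factor is merely continuous: where the other factor vanishes, the term
  with the missing derivative is absent. It differentiates the inverse matrix in the next lemma,
  of which only continuity is known at that stage.\<close>

lemma has_derivative_scaleR_vanishing:
  fixes s :: "'a::real_normed_vector \<Rightarrow> real" and \<beta> :: "'a \<Rightarrow> 'b::real_normed_vector"
  assumes s: "(s has_derivative s') (at x)" and "s x = 0" and \<beta>: "isCont \<beta> x"
  shows "((\<lambda>y. s y *\<^sub>R \<beta> y) has_derivative (\<lambda>h. s' h *\<^sub>R \<beta> x)) (at x)"
proof -
  have bl: "bounded_linear s'" using s by (rule has_derivative_bounded_linear)
  then obtain C where C: "C > 0" "\<And>h. norm (s' h) \<le> norm h * C"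
    using bounded_linear.pos_bounded by blast
  have s_alt: "\<And>e. e > 0 \<Longrightarrow> \<exists>d>0. \<forall>y. norm (y - x) < d \<longrightarrow> norm (s y - s x - s' (y - x)) \<le> e * norm (y - x)"
    using s unfolding has_derivative_at_alt by blast
  have z: "((\<lambda>y. s y *\<^sub>R (\<beta> y - \<beta> x)) has_derivative (\<lambda>h. 0)) (at x)"
    unfolding has_derivative_at_alt
  proof (intro conjI allI impI)
    fix e :: real assume e: "e > 0"
    obtain d1 where d1: "d1 > 0" "\<And>y. norm (y - x) < d1 \<Longrightarrow> norm (s y - s x - s' (y - x)) \<le> 1 * norm (y - x)"
      using s_alt[of 1] by auto
    have "e / (C + 1) > 0" using e C by simp
    then obtain d2 where d2: "d2 > 0" "\<And>y. dist y x < d2 \<Longrightarrow> dist (\<beta> y) (\<beta> x) < e / (C + 1)"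
      using \<beta> unfolding continuous_at_eps_delta by blast
    have "norm (s y *\<^sub>R (\<beta> y - \<beta> x)) \<le> e * norm (y - x)" if y: "norm (y - x) < min d1 d2" for y
    proof -
      have "norm (s y - s' (y - x)) \<le> norm (y - x)" using d1(2)[of y] y assms(2) by simp
      then have "\<bar>s y\<bar> \<le> norm (y - x) + \<bar>s' (y - x)\<bar>" by simp
      also have "\<dots> \<le> norm (y - x) * (C + 1)" using C(2)[of "y - x"] by (simp add: algebra_simps)
      finally have 1: "\<bar>s y\<bar> \<le> norm (y - x) * (C + 1)" .
      have 2: "norm (\<beta> y - \<beta> x) \<le> e / (C + 1)"
        using d2(2)[of y] y by (simp add: dist_norm less_imp_le)
      have "norm (s y *\<^sub>R (\<beta> y - \<beta> x)) \<le> (norm (y - x) * (C + 1)) * (e / (C + 1))"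
        unfolding norm_scaleR by (rule mult_mono[OF 1 2]) (use C in auto)
      also have "\<dots> = e * norm (y - x)" using C(1) by simp
      finally show ?thesis .
    qed
    then show "\<exists>d>0. \<forall>y. norm (y - x) < d \<longrightarrow>
        norm (s y *\<^sub>R (\<beta> y - \<beta> x) - s x *\<^sub>R (\<beta> x - \<beta> x) - 0) \<le> e * norm (y - x)"
      using d1(1) d2(1) by (intro exI[of _ "min d1 d2"]) auto
  qed auto
  have "((\<lambda>y. s y *\<^sub>R \<beta> x + s y *\<^sub>R (\<beta> y - \<beta> x)) has_derivative (\<lambda>h. s' h *\<^sub>R \<beta> x + 0)) (at x)"
    by (rule has_derivative_add[OF has_derivative_scaleR_left[OF s] z])
  then show ?thesis by (simp add: scaleR_diff_right)
qed

text \<open>The derivative of the inverse \<open>g\<close> at \<open>y\<close> is \<open>B(y) = A(g y)\<^sup>-\<^sup>1\<close> with \<open>A = Df\<close>, and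
  \<open>DB(y) h = - B(y) (DA(g y)(B(y) h)) B(y)\<close>. So the derivatives of both \<open>g\<close> and \<open>B\<close> are
  polynomials in the entries of \<open>B\<close> and of the smooth map \<open>DA\<close> at \<open>g y\<close>. Hence if \<open>g\<close> and
  \<open>B\<close> are \<open>C\<^sup>k\<close>, then they are \<open>C\<^sup>k\<^sup>+\<^sup>1\<close>, and a simultaneous induction shows that
  \<open>g\<close> is smooth. In the proof \<open>B(y)\<close> is called \<open>g' y\<close>, and \<open>N v h y\<close> is the value of
  \<open>DA(g y)(B(y) h) (B(y) v)\<close> written out in a basis.\<close>

lemma smooth_local_inverse:
  fixes f :: "'a::euclidean_space \<Rightarrow> 'a"
  assumes "open U" and f: "\<And>k. Ck_on k U f" and "x0 \<in> U"
    and inj: "inj (frechet_derivative f (at x0))"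
  obtains U' V g where "open U'" "U' \<subseteq> U" "x0 \<in> U'" "open V" "homeomorphism U' V f g"
    "\<And>k. Ck_on k V g"
proof -
  let ?A = "\<lambda>x. frechet_derivative f (at x)"
  have D: "(f has_derivative ?A x) (at x)" if "x \<in> U" for x
    using Ck_on_has_derivative[OF f that] .
  have lin: "linear (?A x)" if "x \<in> U" for x
    using has_derivative_linear[OF D[OF that]] .
  obtain c where c: "c > 0" "\<And>v. c * norm v \<le> norm (?A x0 v)"
    using linear_inj_bounded_below_pos[OF lin[OF assms(3)] inj] by (metis mult.commute)
  \<comment> \<open>On this ball the derivatives stay uniformly invertible, which bounds \<open>g'\<close> and makes it continuous.\<close>
  obtain r where r: "r > 0" "ball x0 r \<subseteq> U"
    "\<And>x v. x \<in> ball x0 r \<Longrightarrow> norm (?A x v - ?A x0 v) \<le> c / 2 * norm v"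
    using derivative_near_basepoint[OF assms(1) f[of "Suc 0"] assms(3), of "c / 2"] c by auto
  have below: "c / 2 * norm v \<le> norm (?A x v)" if "x \<in> ball x0 r" for x v
  proof -
    have "norm (?A x0 v) \<le> norm (?A x v) + norm (?A x v - ?A x0 v)"
      by (metis norm_minus_commute norm_triangle_sub)
    then show ?thesis using r(3)[OF that, of v] c(2)[of v] by linarith
  qed
  define f' where "f' x = Blinfun (?A x)" for x
  have f': "blinfun_apply (f' x) = ?A x" if "x \<in> U" for x
    unfolding f'_def
    by (rule bounded_linear_Blinfun_apply[OF has_derivative_bounded_linear[OF D[OF that]]])
  have x0: "x0 \<in> ball x0 r" using r by simp
  have cont: "continuous_on (ball x0 r) f'"
  proof (rule continuous_on_blinfun_componentwise)
    fix i :: 'a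
    have "continuous_on (ball x0 r) (\<lambda>x. ?A x i)"
      using f[of "Suc 0"] r(2) by (auto intro: continuous_on_subset)
    then show "continuous_on (ball x0 r) (\<lambda>x. blinfun_apply (f' x) i)"
      by (rule continuous_on_eq) (use f' r(2) in auto)
  qed
  obtain l where l: "linear l" "l \<circ> ?A x0 = id"
    using linear_injective_left_inverse[OF lin[OF assms(3)] inj] by blast
  have l_apply: "blinfun_apply (Blinfun l) = l"
    using l(1) by (simp add: bounded_linear_Blinfun_apply linear_conv_bounded_linear)
  have inv_f': "Blinfun l o\<^sub>L f' x0 = id_blinfun"
  proof (rule blinfun_eqI)
    fix v
    have "l (?A x0 v) = v" using l(2) by (metis comp_apply id_apply)
    then show "blinfun_apply (Blinfun l o\<^sub>L f' x0) v = blinfun_apply id_blinfun v"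
      by (simp add: l_apply f'[OF assms(3)])
  qed
  have der: "(f has_derivative blinfun_apply (f' x)) (at x)" if "x \<in> ball x0 r" for x
    using D[of x] f'[of x] that r(2) by auto
  obtain U' V g g' where inv: "open U'" "U' \<subseteq> ball x0 r" "x0 \<in> U'" "open V" "f x0 \<in> V"
      "homeomorphism U' V f g"
      and g': "\<And>y. y \<in> V \<Longrightarrow> (g has_derivative (g' y)) (at y)"
        "\<And>y. y \<in> V \<Longrightarrow> g' y = inv (blinfun_apply (f' (g y)))"
        "\<And>y. y \<in> V \<Longrightarrow> bij (blinfun_apply (f' (g y)))"
    by (rule inverse_function_theorem[OF open_ball der cont x0 inv_f']) (assumption, rule that)
  have gU': "g y \<in> U'" if "y \<in> V" for y
    using inv(6) that by (auto simp: homeomorphism_def)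
  then have gU: "g y \<in> ball x0 r" "g y \<in> U" if "y \<in> V" for y
    using inv(2) r(2) that by blast+
  have bij: "bij (?A (g y))" and g'_inv: "g' y = inv (?A (g y))" if "y \<in> V" for y
    using g'(2,3)[OF that] f'[OF gU(2)[OF that]] by auto
  have g'A: "g' y (?A (g y) v) = v" and Ag': "?A (g y) (g' y v) = v" if "y \<in> V" for y v
    unfolding g'_inv[OF that]
    using bij[OF that] by (auto simp: bij_is_inj bij_is_surj surj_f_inv_f)
  have g'_lin: "linear (g' y)" if "y \<in> V" for y
    using g'(1)[OF that] by (rule has_derivative_linear)
  have g'_bound: "norm (g' y v) \<le> 2 / c * norm v" if "y \<in> V" for y v
    using below[OF gU(1)[OF that], of "g' y v"] c(1) by (simp add: Ag'[OF that] field_simps)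
  have g_cont: "continuous_on V g" using inv(6) by (simp add: homeomorphism_def)
  let ?q = "\<lambda>w y. ?A (g y) w"
  have q_cont: "isCont (?q w) y" if "y \<in> V" for y w
  proof -
    have "continuous_on U (\<lambda>x. ?A x w)" using f[of "Suc 0"] by auto
    then have "continuous_on V (?q w)"
      using gU g_cont by (auto intro: continuous_on_compose2)
    then show ?thesis using inv(4) that continuous_on_eq_continuous_at by blast
  qed
  \<comment> \<open>the resolvent identity \<open>B(y) - B(y\<^sub>0) = B(y) (A(g y\<^sub>0) - A(g y)) B(y\<^sub>0)\<close>\<close>
  have g'_diff: "g' y v - g' y0 v = g' y (?q (g' y0 v) y0 - ?q (g' y0 v) y)" if "y \<in> V" "y0 \<in> V" for y y0 v
    by (simp add: linear_diff[OF g'_lin] that Ag' g'A)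
  have g'_cont: "isCont (\<lambda>y. g' y v) y0" if "y0 \<in> V" for y0 v
  proof -
    have "((\<lambda>y. g' y v - g' y0 v) \<longlongrightarrow> 0) (at y0)"
    proof (rule Lim_null_comparison)
      show "\<forall>\<^sub>F y in at y0. norm (g' y v - g' y0 v) \<le> 2 / c * norm (?q (g' y0 v) y0 - ?q (g' y0 v) y)"
        using eventually_at_topological inv(4) that g'_bound g'_diff
        by (metis (mono_tags, lifting))
      have "((\<lambda>y. 2 / c * norm (?q (g' y0 v) y0 - ?q (g' y0 v) y)) \<longlongrightarrow>
          2 / c * norm (?q (g' y0 v) y0 - ?q (g' y0 v) y0)) (at y0)"
        using q_cont[OF that, of "g' y0 v"] unfolding isCont_def by (intro tendsto_intros)
      then show "((\<lambda>y. 2 / c * norm (?q (g' y0 v) y0 - ?q (g' y0 v) y)) \<longlongrightarrow> 0) (at y0)" by simp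
    qed
    then show ?thesis unfolding isCont_def by (rule LIM_zero_cancel)
  qed
  let ?a = "\<lambda>d c x. frechet_derivative (\<lambda>x. ?A x c) (at x) d"
  define N where "N v h y = (\<Sum>c\<in>Basis. \<Sum>d\<in>Basis. ((g' y v \<bullet> c) * (g' y h \<bullet> d)) *\<^sub>R ?a d c (g y))"
    for v h y
  have q_der: "(?q (g' y0 v) has_derivative (\<lambda>h. N v h y0)) (at y0)" if "y0 \<in> V" for y0 v
  proof -
    have Ac: "((\<lambda>x. ?A x c) has_derivative (\<lambda>d. ?a d c (g y0))) (at (g y0))" for c
      using f[of "Suc (Suc 0)"] Ck_on_has_derivative[of 0 U "\<lambda>x. ?A x c"] gU[OF that] by simp
    have "((\<lambda>y. \<Sum>c\<in>Basis. (g' y0 v \<bullet> c) *\<^sub>R ?A (g y) c) has_derivative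
        (\<lambda>h. \<Sum>c\<in>Basis. (g' y0 v \<bullet> c) *\<^sub>R ?a (g' y0 h) c (g y0))) (at y0)"
      by (intro has_derivative_sum has_derivative_scaleR_right
          has_derivative_compose[OF g'(1)[OF that] Ac])
    moreover have "(\<Sum>c\<in>Basis. (g' y0 v \<bullet> c) *\<^sub>R ?a (g' y0 h) c (g y0)) = N v h y0" for h
    proof -
      have "(g' y0 v \<bullet> c) *\<^sub>R ?a (g' y0 h) c (g y0) =
          (\<Sum>d\<in>Basis. ((g' y0 v \<bullet> c) * (g' y0 h \<bullet> d)) *\<^sub>R ?a d c (g y0))" for c
        unfolding linear_basis_expansion[OF has_derivative_linear[OF Ac[of c]], where v = "g' y0 h"]
        by (simp only: scaleR_sum_right scaleR_scaleR)
      then show ?thesis by (simp only: N_def)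
    qed
    ultimately have "((\<lambda>y. \<Sum>c\<in>Basis. (g' y0 v \<bullet> c) *\<^sub>R ?A (g y) c) has_derivative
        (\<lambda>h. N v h y0)) (at y0)" by simp
    then show ?thesis
      by (rule has_derivative_transform_within_open[OF _ inv(4) that])
        (rule linear_basis_expansion[OF lin[OF gU(2)], symmetric])
  qed
  have g'_der: "((\<lambda>y. g' y v) has_derivative
      (\<lambda>h. \<Sum>b\<in>Basis. (- (N v h y0 \<bullet> b)) *\<^sub>R g' y0 b)) (at y0)" if "y0 \<in> V" for y0 v
  proof -
    let ?w = "g' y0 v"
    have "((\<lambda>y. \<Sum>b\<in>Basis. ((?q ?w y0 - ?q ?w y) \<bullet> b) *\<^sub>R g' y b) has_derivative
        (\<lambda>h. \<Sum>b\<in>Basis. ((0 - N v h y0) \<bullet> b) *\<^sub>R g' y0 b)) (at y0)"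
      by (intro has_derivative_sum has_derivative_scaleR_vanishing has_derivative_inner_left
          has_derivative_diff has_derivative_const q_der g'_cont that) simp
    then have "((\<lambda>y. g' y0 v + (\<Sum>b\<in>Basis. ((?q ?w y0 - ?q ?w y) \<bullet> b) *\<^sub>R g' y b)) has_derivative
        (\<lambda>h. 0 + (\<Sum>b\<in>Basis. ((0 - N v h y0) \<bullet> b) *\<^sub>R g' y0 b))) (at y0)"
      by (intro has_derivative_add has_derivative_const)
    then have *: "((\<lambda>y. g' y0 v + (\<Sum>b\<in>Basis. ((?q ?w y0 - ?q ?w y) \<bullet> b) *\<^sub>R g' y b)) has_derivative
        (\<lambda>h. \<Sum>b\<in>Basis. (- (N v h y0 \<bullet> b)) *\<^sub>R g' y0 b)) (at y0)"
      by simp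
    have "g' y0 v + (\<Sum>b\<in>Basis. ((?q ?w y0 - ?q ?w y) \<bullet> b) *\<^sub>R g' y b) = g' y v" if y: "y \<in> V" for y
      using linear_basis_expansion[OF g'_lin[OF y], of "?q ?w y0 - ?q ?w y"]
        g'_diff[OF y \<open>y0 \<in> V\<close>, of v] by (simp add: algebra_simps)
    with * show ?thesis
      by (rule has_derivative_transform_within_open[OF _ inv(4) that])
  qed
  have smooth: "Ck_on k V g \<and> (\<forall>v. Ck_on k V (\<lambda>y. g' y v))" for k
  proof (induction k)
    case 0
    show ?case using g_cont g'_cont by (auto intro: continuous_at_imp_continuous_on)
  next
    case (Suc k)
    have a: "Ck_on k V (\<lambda>y. ?a d c (g y))" for c d
    proof -
      have "Ck_on k U (?a d c)" using f[of "Suc (Suc k)"] by simp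
      from Ck_on_compose[OF inv(4) assms(1) _ _ this, of g] show ?thesis
        using Suc gU by auto
    qed
    have B: "Ck_on k V (\<lambda>y. g' y v \<bullet> c)" for v c
      by (rule Ck_on_linear_compose[OF bounded_linear_inner_left inv(4)]) (use Suc in auto)
    have N: "Ck_on k V (\<lambda>y. N v h y)" for v h
      unfolding N_def
      by (rule Ck_on_sum[OF inv(4)], rule Ck_on_sum[OF inv(4)],
          rule Ck_on_bilinear[OF bounded_bilinear_scaleR inv(4)
            Ck_on_bilinear[OF bounded_bilinear_mult inv(4) B B] a])
    have "Ck_on (Suc k) V g"
      by (rule Ck_on_SucI[OF inv(4) g'(1)]) (use Suc in auto)
    moreover have "Ck_on (Suc k) V (\<lambda>y. g' y v)" for v
    proof (rule Ck_on_SucI[OF inv(4) g'_der])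
      fix h
      show "Ck_on k V (\<lambda>y. \<Sum>b\<in>Basis. (- (N v h y \<bullet> b)) *\<^sub>R g' y b)"
      proof (rule Ck_on_sum[OF inv(4)])
        fix b :: 'a
        have "Ck_on k V (\<lambda>y. - (N v h y \<bullet> b))"
          by (rule Ck_on_linear_compose[OF bounded_linear_minus[OF bounded_linear_inner_left] inv(4) N])
        then show "Ck_on k V (\<lambda>y. (- (N v h y \<bullet> b)) *\<^sub>R g' y b)"
          by (rule Ck_on_bilinear[OF bounded_bilinear_scaleR inv(4)]) (use Suc in auto)
      qed
    qed
    ultimately show ?case by blast
  qed
  show ?thesis
    using that[OF inv(1) _ inv(3,4,6)] inv(2) r(2) smooth by blast
qed

section \<open>Smooth maps on arbitrary subsets\<close>

lemma smooth_on_open_iff: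
  assumes "open S"
  shows "smooth_on S f \<longleftrightarrow> (\<forall>k. Ck_on k S f)"
proof
  assume f: "smooth_on S f"
  show "\<forall>k. Ck_on k S f"
  proof (intro allI Ck_on_local)
    fix k x assume x: "x \<in> S"
    obtain U g where U: "open U" "x \<in> U" "\<forall>k. Ck_on k U g" "\<forall>x\<in>S \<inter> U. g x = f x"
      using f[unfolded smooth_on_def, rule_format, OF x] by (elim exE conjE)
    have "Ck_on k (S \<inter> U) f"
      by (rule Ck_on_cong_open[OF open_Int[OF assms U(1)] _ Ck_on_subset[OF U(3)[rule_format]]])
        (use U(4) in auto)
    then show "\<exists>U. open U \<and> x \<in> U \<and> Ck_on k U f"
      using U(1,2) x assms by (intro exI[of _ "S \<inter> U"]) auto
  qed
next
  assume "\<forall>k. Ck_on k S f"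
  then show "smooth_on S f"
    unfolding smooth_on_def using assms by (intro ballI exI[of _ S] exI[of _ f]) auto
qed

lemma smooth_on_extension:
  assumes "smooth_on S f" "p \<in> S"
  obtains U g where "open U" "p \<in> U" "\<And>k. Ck_on k U g" "\<And>x. x \<in> S \<Longrightarrow> x \<in> U \<Longrightarrow> g x = f x"
proof -
  obtain U g where "open U" "p \<in> U" "\<forall>k. Ck_on k U g" "\<forall>x\<in>S \<inter> U. g x = f x"
    using assms(1)[unfolded smooth_on_def, rule_format, OF assms(2)] by (elim exE conjE)
  then show ?thesis by (intro that[of U g]) simp_all
qed

lemma smooth_onI:
  assumes "\<And>p. p \<in> S \<Longrightarrow> \<exists>U g. open U \<and> p \<in> U \<and> (\<forall>k. Ck_on k U g) \<and> (\<forall>x\<in>S \<inter> U. g x = f x)"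
  shows "smooth_on S f"
  unfolding smooth_on_def by (rule ballI) (rule assms)

lemma smooth_on_subset:
  assumes "smooth_on S f" "T \<subseteq> S"
  shows "smooth_on T f"
proof (rule smooth_onI)
  fix p assume "p \<in> T"
  then have "p \<in> S" using assms(2) by blast
  then obtain U g where "open U" "p \<in> U" "\<And>k. Ck_on k U g" "\<And>x. x \<in> S \<Longrightarrow> x \<in> U \<Longrightarrow> g x = f x"
    by (rule smooth_on_extension[OF assms(1)]) (rule that)
  then show "\<exists>U g. open U \<and> p \<in> U \<and> (\<forall>k. Ck_on k U g) \<and> (\<forall>x\<in>T \<inter> U. g x = f x)"
    using assms(2) by (intro exI[of _ U] exI[of _ g]) auto
qed

lemma smooth_on_cong:
  assumes "smooth_on S f" "\<And>x. x \<in> S \<Longrightarrow> g x = f x"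
  shows "smooth_on S g"
proof (rule smooth_onI)
  fix p assume "p \<in> S"
  then obtain U h where "open U" "p \<in> U" "\<And>k. Ck_on k U h" "\<And>x. x \<in> S \<Longrightarrow> x \<in> U \<Longrightarrow> h x = f x"
    by (rule smooth_on_extension[OF assms(1)]) (rule that)
  then show "\<exists>U h. open U \<and> p \<in> U \<and> (\<forall>k. Ck_on k U h) \<and> (\<forall>x\<in>S \<inter> U. h x = g x)"
    using assms(2) by (intro exI[of _ U] exI[of _ h]) auto
qed

lemma smooth_on_Ck:
  assumes "open U" "\<And>k. Ck_on k U f" "S \<subseteq> U"
  shows "smooth_on S f"
  by (rule smooth_on_subset[OF _ assms(3)]) (simp add: smooth_on_open_iff assms)

lemma smooth_on_bounded_linear: "bounded_linear f \<Longrightarrow> smooth_on S f"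
  by (rule smooth_on_Ck[of UNIV]) (auto intro: Ck_on_bounded_linear)

lemma smooth_on_const: "smooth_on S (\<lambda>x. c)"
  by (rule smooth_on_Ck[of UNIV]) (auto intro: Ck_on_const)

lemma smooth_on_imp_continuous_on:
  assumes "smooth_on S f"
  shows "continuous_on S f"
  unfolding continuous_on_eq_continuous_within
proof
  fix p assume p: "p \<in> S"
  obtain U g where U: "open U" "p \<in> U" "\<And>k. Ck_on k U g" "\<And>x. x \<in> S \<Longrightarrow> x \<in> U \<Longrightarrow> g x = f x"
    by (rule smooth_on_extension[OF assms p]) (rule that)
  have "continuous_on (S \<inter> U) g"
    using U(3)[of 0] by (auto intro: continuous_on_subset)
  then have "continuous_on (S \<inter> U) f"
    by (rule continuous_on_eq) (use U in auto)
  then have "continuous (at p within S \<inter> U) f"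
    using p U(2) by (simp add: continuous_on_eq_continuous_within)
  then show "continuous (at p within S) f"
    by (subst at_within_nhd[OF U(2,1), of S "S \<inter> U"]) auto
qed

lemma smooth_on_compose:
  fixes f :: "'a::euclidean_space \<Rightarrow> 'b::euclidean_space" and g :: "'b \<Rightarrow> 'c::real_normed_vector"
  assumes f: "smooth_on S f" and g: "smooth_on T g" and "f ` S \<subseteq> T"
  shows "smooth_on S (\<lambda>x. g (f x))"
  unfolding smooth_on_def
proof
  fix p assume p: "p \<in> S"
  obtain U f' where U: "open U" "p \<in> U" "\<And>k. Ck_on k U f'" "\<And>x. x \<in> S \<Longrightarrow> x \<in> U \<Longrightarrow> f' x = f x"
    by (rule smooth_on_extension[OF f p]) (rule that)
  have "f p \<in> T" using assms(3) p by blast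
  then obtain V g' where V: "open V" "f p \<in> V" "\<And>k. Ck_on k V g'" "\<And>y. y \<in> T \<Longrightarrow> y \<in> V \<Longrightarrow> g' y = g y"
    by (rule smooth_on_extension[OF g]) (rule that)
  let ?U = "U \<inter> f' -` V"
  have o: "open ?U"
    using continuous_open_preimage[OF _ U(1) V(1)] U(3)[of 0] by simp
  have "Ck_on k ?U (\<lambda>x. g' (f' x))" for k
    by (rule Ck_on_compose[OF o V(1) _ _ V(3)]) (auto intro: Ck_on_subset U(3))
  moreover have "p \<in> ?U" using U(2) U(4)[OF p] V(2) by simp
  moreover have "\<forall>x\<in>S \<inter> ?U. g' (f' x) = g (f x)"
  proof
    fix x assume x: "x \<in> S \<inter> ?U"
    then have "f' x = f x" using U(4) by blast
    then show "g' (f' x) = g (f x)" using x V(4)[of "f x"] assms(3) by auto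
  qed
  ultimately show "\<exists>U h. open U \<and> p \<in> U \<and> (\<forall>k. Ck_on k U h) \<and> (\<forall>x\<in>S \<inter> U. h x = g (f x))"
    using o by (intro exI[of _ ?U] exI[of _ "\<lambda>x. g' (f' x)"]) blast
qed

lemma smooth_on_Pair:
  assumes f: "smooth_on S f" and g: "smooth_on S g"
  shows "smooth_on S (\<lambda>x. (f x, g x))"
  unfolding smooth_on_def
proof
  fix p assume p: "p \<in> S"
  obtain U f' where U: "open U" "p \<in> U" "\<And>k. Ck_on k U f'" "\<And>x. x \<in> S \<Longrightarrow> x \<in> U \<Longrightarrow> f' x = f x"
    by (rule smooth_on_extension[OF f p]) (rule that)
  obtain V g' where V: "open V" "p \<in> V" "\<And>k. Ck_on k V g'" "\<And>x. x \<in> S \<Longrightarrow> x \<in> V \<Longrightarrow> g' x = g x"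
    by (rule smooth_on_extension[OF g p]) (rule that)
  have "Ck_on k (U \<inter> V) (\<lambda>x. (f' x, g' x))" for k
    by (rule Ck_on_Pair[OF open_Int[OF U(1) V(1)] Ck_on_subset[OF U(3)] Ck_on_subset[OF V(3)]]) auto
  then show "\<exists>U h. open U \<and> p \<in> U \<and> (\<forall>k. Ck_on k U h) \<and> (\<forall>x\<in>S \<inter> U. h x = (f x, g x))"
    using U(1,2,4) V(1,2,4) by (intro exI[of _ "U \<inter> V"] exI[of _ "\<lambda>x. (f' x, g' x)"]) auto
qed

lemma smooth_on_linear_compose:
  fixes f :: "'a::euclidean_space \<Rightarrow> 'b::euclidean_space"
  shows "bounded_linear l \<Longrightarrow> smooth_on S f \<Longrightarrow> smooth_on S (\<lambda>x. l (f x))"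
  by (rule smooth_on_compose[where T = UNIV]) (auto intro: smooth_on_bounded_linear)

lemma smooth_on_bilinear:
  fixes f :: "'a::euclidean_space \<Rightarrow> 'b::euclidean_space" and g :: "'a \<Rightarrow> 'c::euclidean_space"
  assumes b: "bounded_bilinear b" and "smooth_on S f" "smooth_on S g"
  shows "smooth_on S (\<lambda>x. b (f x) (g x))"
proof -
  have "Ck_on k UNIV (\<lambda>z. b (fst z) (snd z))" for k
    by (rule Ck_on_bilinear[OF b open_UNIV]) (auto intro: Ck_on_bounded_linear bounded_linear_fst bounded_linear_snd)
  then have "smooth_on UNIV (\<lambda>z. b (fst z) (snd z))" by (intro smooth_on_Ck[OF open_UNIV]) auto
  from smooth_on_compose[OF smooth_on_Pair[OF assms(2,3)] this] show ?thesis by simp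
qed

lemma smooth_on_add:
  fixes f g :: "'a::euclidean_space \<Rightarrow> 'b::euclidean_space"
  assumes "smooth_on S f" "smooth_on S g"
  shows "smooth_on S (\<lambda>x. f x + g x)"
proof -
  have "bounded_linear (\<lambda>z::'b \<times> 'b. fst z + snd z)"
    by (intro bounded_linear_add bounded_linear_fst bounded_linear_snd)
  from smooth_on_linear_compose[OF this smooth_on_Pair[OF assms]] show ?thesis by simp
qed

lemma Ck_on_locally_lipschitz:
  fixes f :: "'a::euclidean_space \<Rightarrow> 'b::real_normed_vector"
  assumes "open U" "Ck_on (Suc 0) U f" "p \<in> U"
  obtains r C where "r > 0" "C > 0" "ball p r \<subseteq> U"
    "\<And>x y. x \<in> ball p r \<Longrightarrow> y \<in> ball p r \<Longrightarrow> dist (f x) (f y) \<le> C * dist x y"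
proof -
  obtain r where r: "r > 0" "ball p r \<subseteq> U"
    "\<And>x y. x \<in> ball p r \<Longrightarrow> y \<in> ball p r \<Longrightarrow>
      norm (f x - f y - frechet_derivative f (at p) (x - y)) \<le> 1 * norm (x - y)"
    by (rule strictly_differentiable[OF assms zero_less_one]) (rule that)
  obtain K where K: "K > 0" "\<And>v. norm (frechet_derivative f (at p) v) \<le> norm v * K"
    using bounded_linear.pos_bounded[OF has_derivative_bounded_linear[OF Ck_on_has_derivative[OF assms(2,3)]]]
    by blast
  show ?thesis
  proof (rule that[OF r(1) _ r(2), of "K + 1"])
    fix x y assume xy: "x \<in> ball p r" "y \<in> ball p r"
    have "norm (f x - f y) \<le> norm (f x - f y - frechet_derivative f (at p) (x - y))
        + norm (frechet_derivative f (at p) (x - y))"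
      by (metis add.commute norm_triangle_sub)
    also have "\<dots> \<le> norm (x - y) + norm (x - y) * K"
      using r(3)[OF xy] K(2)[of "x - y"] by simp
    finally show "dist (f x) (f y) \<le> (K + 1) * dist x y"
      by (simp add: dist_norm algebra_simps)
  qed (use K in simp)
qed

section \<open>Submanifolds and maps bounded below\<close>

lemma local_parametrization_smooth:
  assumes "local_parametrization M W \<psi>"
  shows "open W" "inj_on \<psi> W" "\<And>k. Ck_on k W \<psi>" "\<psi> ` W \<subseteq> M"
proof -
  have *: "open W" "openin (top_of_set M) (\<psi> ` W)" "inj_on \<psi> W" "smooth_on W \<psi>"
    using assms unfolding local_parametrization_def diffeomorphism_betw_def bij_betw_def by auto
  then show "open W" "inj_on \<psi> W" "\<And>k. Ck_on k W \<psi>" by (auto simp: smooth_on_open_iff)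
  show "\<psi> ` W \<subseteq> M" using *(2) by (rule openin_imp_subset)
qed

text \<open>A chart as an ambient smooth map \<open>k\<close> on an open set, shrunk so that every point of \<open>M\<close> in it
  is in the image of the parametrization.\<close>

lemma local_parametrization_inverse:
  assumes "local_parametrization M W \<psi>" "w \<in> W"
  obtains U k where "open U" "\<psi> w \<in> U" "\<And>n. Ck_on n U k"
    "\<And>x. x \<in> M \<Longrightarrow> x \<in> U \<Longrightarrow> k x \<in> W \<and> \<psi> (k x) = x"
    "\<And>w. w \<in> W \<Longrightarrow> \<psi> w \<in> U \<Longrightarrow> k (\<psi> w) = w"
proof -
  have "smooth_on (\<psi> ` W) (inv_into W \<psi>)" and op: "openin (top_of_set M) (\<psi> ` W)"
    and inj: "inj_on \<psi> W"
    using assms unfolding local_parametrization_def diffeomorphism_betw_def bij_betw_def by auto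
  then obtain U k where U: "open U" "\<psi> w \<in> U" "\<And>n. Ck_on n U k"
    "\<And>x. x \<in> \<psi> ` W \<Longrightarrow> x \<in> U \<Longrightarrow> k x = inv_into W \<psi> x"
    using smooth_on_extension[of "\<psi> ` W" "inv_into W \<psi>" "\<psi> w"] assms(2) by blast
  obtain O' where O: "open O'" "\<psi> ` W = M \<inter> O'" using op by (auto simp: openin_open)
  show ?thesis
  proof (rule that[of "U \<inter> O'" k])
    show "open (U \<inter> O')" using U O by blast
    show "\<psi> w \<in> U \<inter> O'" using U(2) O(2) assms(2) by blast
    show "Ck_on n (U \<inter> O') k" for n by (rule Ck_on_subset[OF U(3)]) auto
    show "k x \<in> W \<and> \<psi> (k x) = x" if "x \<in> M" "x \<in> U \<inter> O'" for x
    proof -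
      have "x \<in> \<psi> ` W" using that O by blast
      then show ?thesis using U(4)[of x] that by (simp add: inv_into_into f_inv_into_f)
    qed
    show "k (\<psi> w) = w" if "w \<in> W" "\<psi> w \<in> U \<inter> O'" for w
      using U(4)[of "\<psi> w"] that inj by (simp add: inv_into_f_f)
  qed
qed

text \<open>The lower bound makes \<open>\<Phi>\<close> injective with continuous inverse and, in a chart, its derivative
  injective. Composing with a linear left inverse \<open>P\<close> of that derivative gives a map between
  spaces of equal dimension, which has a smooth local inverse \<open>g\<close>. Then \<open>\<psi> \<circ> g \<circ> P\<close>
  is an ambient smooth extension of the inverse of \<open>\<Phi>\<close>; the lower bound keeps preimages of
  points near \<open>\<Phi> p\<close> near \<open>p\<close>, so that the extension is correct on the whole of \<open>\<Phi> ` M\<close>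
  nearby.\<close>

lemma diffeomorphism_of_lower_bound:
  fixes \<Phi> :: "'a::euclidean_space \<Rightarrow> 'b::euclidean_space"
  assumes M: "smooth_submanifold TYPE('m::euclidean_space) M" and \<Phi>: "smooth_on M \<Phi>"
    and "c > 0" and low: "\<And>x y. x \<in> M \<Longrightarrow> y \<in> M \<Longrightarrow> c * dist x y \<le> dist (\<Phi> x) (\<Phi> y)"
  shows "diffeomorphism_betw M (\<Phi> ` M) \<Phi>"
proof -
  have inj: "inj_on \<Phi> M"
  proof (rule inj_onI)
    fix x y assume "x \<in> M" "y \<in> M" "\<Phi> x = \<Phi> y"
    then have "c * dist x y \<le> 0" using low[of x y] by simp
    then show "x = y" using assms(3) by (simp add: mult_le_0_iff)
  qed
  have "\<exists>Y e. open Y \<and> \<Phi> p \<in> Y \<and> (\<forall>k. Ck_on k Y e) \<and> (\<forall>y\<in>\<Phi> ` M \<inter> Y. e y = inv_into M \<Phi> y)"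
    if p: "p \<in> M" for p
  proof -
    obtain W :: "'m set" and \<psi> where par: "local_parametrization M W \<psi>" and "p \<in> \<psi> ` W"
      using M p unfolding smooth_submanifold_def by blast
    then obtain w0 where w0: "w0 \<in> W" "\<psi> w0 = p" by blast
    note \<psi> = local_parametrization_smooth[OF par]
    obtain Uk k where k: "open Uk" "p \<in> Uk" "\<And>n. Ck_on n Uk k"
      "\<And>x. x \<in> M \<Longrightarrow> x \<in> Uk \<Longrightarrow> k x \<in> W \<and> \<psi> (k x) = x"
      "\<And>w. w \<in> W \<Longrightarrow> \<psi> w \<in> Uk \<Longrightarrow> k (\<psi> w) = w"
      by (rule local_parametrization_inverse[OF par w0(1), unfolded w0(2)]) (rule that)
    obtain r C where r: "r > 0" "C > 0" "ball p r \<subseteq> Uk"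
      "\<And>x y. x \<in> ball p r \<Longrightarrow> y \<in> ball p r \<Longrightarrow> dist (k x) (k y) \<le> C * dist x y"
      by (rule Ck_on_locally_lipschitz[OF k(1) k(3) k(2)]) (rule that)
    obtain U \<Phi>' where U: "open U" "p \<in> U" "\<And>n. Ck_on n U \<Phi>'" "\<And>x. x \<in> M \<Longrightarrow> x \<in> U \<Longrightarrow> \<Phi>' x = \<Phi> x"
      by (rule smooth_on_extension[OF \<Phi> p]) (rule that)
    define W' where "W' = W \<inter> \<psi> -` (U \<inter> ball p r)"
    have W': "open W'" "w0 \<in> W'" "W' \<subseteq> W"
      unfolding W'_def
      using continuous_open_preimage[OF _ \<psi>(1), of \<psi> "U \<inter> ball p r"] \<psi>(3)[of 0] U(1,2) w0 r(1) by auto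
    let ?f = "\<lambda>w. \<Phi>' (\<psi> w)"
    have f: "Ck_on n W' ?f" for n
      by (rule Ck_on_compose[OF W'(1) U(1) _ Ck_on_subset[OF \<psi>(3) W'(3)] U(3)]) (auto simp: W'_def)
    have f_eq: "?f w = \<Phi> (\<psi> w)" "\<psi> w \<in> M" if "w \<in> W'" for w
      using that U(4)[of "\<psi> w"] \<psi>(4) unfolding W'_def by auto
    have f_low: "c / C * dist w w0 \<le> dist (?f w) (?f w0)" if w: "w \<in> W'" for w
    proof -
      have "dist w w0 = dist (k (\<psi> w)) (k (\<psi> w0))"
        using k(5)[of w] k(5)[of w0] w W'(2) subsetD[OF r(3), of "\<psi> w"]
          subsetD[OF r(3), of "\<psi> w0"] unfolding W'_def by simp
      also have "\<dots> \<le> C * dist (\<psi> w) (\<psi> w0)"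
        using r(4) w W'(2) unfolding W'_def by auto
      finally have "c / C * dist w w0 \<le> c / C * (C * dist (\<psi> w) (\<psi> w0))"
        using assms(3) r(2) by (intro mult_left_mono) auto
      also have "\<dots> = c * dist (\<psi> w) (\<psi> w0)" using r(2) by simp
      also have "\<dots> \<le> dist (?f w) (?f w0)" using low f_eq[OF w] f_eq[OF W'(2)] by metis
      finally show ?thesis .
    qed
    have Df: "(?f has_derivative frechet_derivative ?f (at w0)) (at w0)"
      using Ck_on_has_derivative[OF f W'(2)] .
    have "inj (frechet_derivative ?f (at w0))"
      by (rule inj_derivative_of_lower_bound[OF Df W'(1,2) _ f_low]) (use assms(3) r(2) in auto)
    then obtain P where P: "linear P" "P \<circ> frechet_derivative ?f (at w0) = id"
      using linear_injective_left_inverse[OF has_derivative_linear[OF Df]] by blast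
    have bP: "bounded_linear P" using P(1) by (simp add: linear_conv_bounded_linear)
    let ?F = "\<lambda>w. P (?f w)"
    have F: "Ck_on n W' ?F" for n by (rule Ck_on_linear_compose[OF bP W'(1) f])
    have "(?F has_derivative (\<lambda>v. P (frechet_derivative ?f (at w0) v))) (at w0)"
      by (rule bounded_linear.has_derivative[OF bP Df])
    then have "frechet_derivative ?F (at w0) = P \<circ> frechet_derivative ?f (at w0)"
      unfolding comp_def by (rule frechet_derivative_at[symmetric])
    then have "frechet_derivative ?F (at w0) = id" using P(2) by simp
    then have injF: "inj (frechet_derivative ?F (at w0))" by simp
    obtain U' V g where inv: "open U'" "U' \<subseteq> W'" "w0 \<in> U'" "open V" "homeomorphism U' V ?F g"
        "\<And>n. Ck_on n V g"
      by (rule smooth_local_inverse[OF W'(1) F W'(2) injF]) (rule that)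
    \<comment> \<open>Points of \<open>M\<close> in \<open>N\<close> have their coordinate in the domain where \<open>g\<close> inverts \<open>P \<circ> f\<close>.\<close>
    define N where "N = Uk \<inter> k -` U'"
    have "open N" "p \<in> N"
      unfolding N_def using continuous_open_preimage[OF _ k(1) inv(1), of k] k(3)[of 0] k(2) k(5)[of w0] w0 inv(3)
      by auto
    then obtain \<rho> where \<rho>: "\<rho> > 0" "ball p \<rho> \<subseteq> N" using openE by blast
    define Y where "Y = P -` V \<inter> ball (\<Phi> p) (c * \<rho>)"
    have "open (P -` V)"
      using continuous_open_vimage[OF inv(4), of P] linear_continuous_at[OF bP] by blast
    then have Y: "open Y" unfolding Y_def by blast
    have "P (\<Phi> p) = ?F w0" using f_eq[OF W'(2)] w0 by simp
    then have pY: "\<Phi> p \<in> Y"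
      unfolding Y_def using inv(3,5) \<rho>(1) assms(3) by (auto simp: homeomorphism_def)
    have gV: "g ` V \<subseteq> W" using inv(2,5) W'(3) by (auto simp: homeomorphism_def)
    have "Ck_on n Y (\<lambda>y. g (P y))" for n
      by (rule Ck_on_compose[OF Y inv(4) _ Ck_on_bounded_linear[OF Y bP] inv(6)]) (auto simp: Y_def)
    then have "Ck_on n Y (\<lambda>y. \<psi> (g (P y)))" for n
      by (rule Ck_on_compose[OF Y \<psi>(1) _ _ \<psi>(3), rotated]) (use gV in \<open>auto simp: Y_def\<close>)
    moreover have "\<psi> (g (P y)) = inv_into M \<Phi> y" if y: "y \<in> \<Phi> ` M \<inter> Y" for y
    proof -
      obtain x where x: "x \<in> M" "y = \<Phi> x" using y by blast
      have "c * dist p x < c * \<rho>" using low[OF p x(1)] y x(2) unfolding Y_def by auto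
      then have "x \<in> N" using \<rho>(2) assms(3) by auto
      then have kx: "k x \<in> U'" "\<psi> (k x) = x" using k(4)[OF x(1)] unfolding N_def by auto
      then have "?F (k x) = P y" using f_eq(1)[of "k x"] inv(2) x(2) by auto
      then have "g (P y) = k x" using inv(5) kx(1) by (metis homeomorphism_apply1)
      then show ?thesis using kx(2) x inj by (simp add: inv_into_f_f)
    qed
    ultimately show ?thesis using Y pY by (intro exI[of _ Y] exI[of _ "\<lambda>y. \<psi> (g (P y))"]) auto
  qed
  then have "smooth_on (\<Phi> ` M) (inv_into M \<Phi>)" unfolding smooth_on_def by auto
  then show ?thesis unfolding diffeomorphism_betw_def using inj \<Phi> by (simp add: bij_betw_def)
qed

lemma submanifold_diffeomorphic_image:
  fixes \<Phi> :: "'a::euclidean_space \<Rightarrow> 'b::euclidean_space"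
  assumes M: "smooth_submanifold TYPE('m::euclidean_space) M" and \<Phi>: "diffeomorphism_betw M N \<Phi>"
  shows "smooth_submanifold TYPE('m) N"
  unfolding smooth_submanifold_def
proof
  fix q assume q: "q \<in> N"
  let ?\<Theta> = "inv_into M \<Phi>"
  have bij: "bij_betw \<Phi> M N" and sm: "smooth_on M \<Phi>" and sm': "smooth_on N ?\<Theta>"
    using \<Phi> unfolding diffeomorphism_betw_def by auto
  have inj: "inj_on \<Phi> M" and im: "\<Phi> ` M = N" using bij by (auto simp: bij_betw_def)
  have "?\<Theta> q \<in> M" using q im by (auto intro: inv_into_into)
  then obtain W :: "'m set" and \<psi> where par: "local_parametrization M W \<psi>" and "?\<Theta> q \<in> \<psi> ` W"
    using M unfolding smooth_submanifold_def by blast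
  then obtain w0 where w0: "w0 \<in> W" "\<psi> w0 = ?\<Theta> q" by force
  note \<psi> = local_parametrization_smooth[OF par]
  have op: "openin (top_of_set M) (\<psi> ` W)" and \<psi>W: "smooth_on W \<psi>"
    and \<psi>inv: "smooth_on (\<psi> ` W) (inv_into W \<psi>)"
    using par unfolding local_parametrization_def diffeomorphism_betw_def by auto
  let ?\<chi> = "\<lambda>w. \<Phi> (\<psi> w)"
  have \<Theta>\<chi>: "?\<Theta> (?\<chi> w) = \<psi> w" if "w \<in> W" for w
    using inj \<psi>(4) that by (auto intro!: inv_into_f_f)
  have \<Phi>\<Theta>: "\<Phi> (?\<Theta> y) = y" if "y \<in> N" for y using that im by (simp add: f_inv_into_f)
  have im\<chi>: "?\<chi> ` W = N \<inter> ?\<Theta> -` (\<psi> ` W)"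
  proof (intro equalityI subsetI)
    fix y assume "y \<in> ?\<chi> ` W"
    then show "y \<in> N \<inter> ?\<Theta> -` (\<psi> ` W)" using \<Theta>\<chi> im \<psi>(4) by auto
  next
    fix y assume y: "y \<in> N \<inter> ?\<Theta> -` (\<psi> ` W)"
    then obtain w where "w \<in> W" "?\<Theta> y = \<psi> w" by auto
    then have "y = ?\<chi> w" using \<Phi>\<Theta>[of y] y by simp
    then show "y \<in> ?\<chi> ` W" using \<open>w \<in> W\<close> by blast
  qed
  have "openin (top_of_set N) (?\<chi> ` W)"
    unfolding im\<chi>
    by (rule continuous_openin_preimage[OF smooth_on_imp_continuous_on[OF sm'] _ op])
      (use im in \<open>auto intro: inv_into_into\<close>)
  moreover have inj\<chi>: "inj_on ?\<chi> W"
    using comp_inj_on[OF \<psi>(2) inj_on_subset[OF inj \<psi>(4)]] by (simp add: o_def)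
  moreover have "smooth_on W ?\<chi>" by (rule smooth_on_compose[OF \<psi>W sm \<psi>(4)])
  moreover have "smooth_on (?\<chi> ` W) (inv_into W ?\<chi>)"
  proof (rule smooth_on_cong[where f = "\<lambda>y. inv_into W \<psi> (?\<Theta> y)"])
    show "smooth_on (?\<chi> ` W) (\<lambda>y. inv_into W \<psi> (?\<Theta> y))"
      by (rule smooth_on_compose[OF smooth_on_subset[OF sm'] \<psi>inv]) (use im\<chi> in auto)
    fix y assume "y \<in> ?\<chi> ` W"
    then show "inv_into W ?\<chi> y = inv_into W \<psi> (?\<Theta> y)"
      using \<Theta>\<chi> by (auto simp: inv_into_f_f[OF inj\<chi>] inv_into_f_f[OF \<psi>(2)])
  qed
  ultimately have "local_parametrization N W ?\<chi>"
    unfolding local_parametrization_def diffeomorphism_betw_def bij_betw_def using \<psi>(1) by simp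
  moreover have "q \<in> ?\<chi> ` W" using w0 \<Phi>\<Theta>[OF q] by force
  ultimately show "\<exists>(W::'m set) \<psi>. local_parametrization N W \<psi> \<and> q \<in> \<psi> ` W" by blast
qed

lemma smooth_on_cylinder_map:
  fixes f :: "'a::euclidean_space \<Rightarrow> 'b::euclidean_space"
  assumes "smooth_on S f"
  shows "smooth_on (UNIV \<times> S) (\<lambda>z::real \<times> 'a. (fst z, f (snd z)))"
  by (rule smooth_on_Pair[OF smooth_on_bounded_linear[OF bounded_linear_fst]
        smooth_on_compose[OF smooth_on_bounded_linear[OF bounded_linear_snd] assms]]) auto

lemma submanifold_cylinder:
  fixes M :: "'a::euclidean_space set"
  assumes M: "smooth_submanifold TYPE('m::euclidean_space) M"
  shows "smooth_submanifold TYPE(real \<times> 'm) ((UNIV :: real set) \<times> M)"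
  unfolding smooth_submanifold_def
proof
  fix x assume x: "x \<in> (UNIV :: real set) \<times> M"
  then have "snd x \<in> M" by auto
  then obtain W :: "'m set" and \<psi> where par: "local_parametrization M W \<psi>" and xW: "snd x \<in> \<psi> ` W"
    using M unfolding smooth_submanifold_def by blast
  note \<psi> = local_parametrization_smooth[OF par]
  have op: "openin (top_of_set M) (\<psi> ` W)" and \<psi>W: "smooth_on W \<psi>"
    and \<psi>inv: "smooth_on (\<psi> ` W) (inv_into W \<psi>)"
    using par unfolding local_parametrization_def diffeomorphism_betw_def by auto
  let ?\<chi> = "\<lambda>z::real \<times> 'm. (fst z, \<psi> (snd z))"
  have im: "?\<chi> ` (UNIV \<times> W) = UNIV \<times> \<psi> ` W" by force
  have inj: "inj_on ?\<chi> (UNIV \<times> W)" using \<psi>(2) by (auto simp: inj_on_def)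
  have "smooth_on (UNIV \<times> \<psi> ` W) (inv_into (UNIV \<times> W) ?\<chi>)"
  proof (rule smooth_on_cong[OF smooth_on_cylinder_map[OF \<psi>inv]])
    fix z :: "real \<times> 'a" assume "z \<in> UNIV \<times> \<psi> ` W"
    then obtain t w where z: "z = ?\<chi> (t, w)" "w \<in> W" by auto
    then have "inv_into (UNIV \<times> W) ?\<chi> z = (t, w)" using inv_into_f_f[OF inj, of "(t, w)"] by simp
    then show "inv_into (UNIV \<times> W) ?\<chi> z = (fst z, inv_into W \<psi> (snd z))"
      using z by (simp add: inv_into_f_f[OF \<psi>(2)])
  qed
  moreover have "openin (top_of_set (UNIV \<times> M)) ((UNIV :: real set) \<times> \<psi> ` W)"
    using op by (intro openin_Times) auto
  ultimately have "local_parametrization (UNIV \<times> M) (UNIV \<times> W) ?\<chi>"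
    unfolding local_parametrization_def diffeomorphism_betw_def bij_betw_def im
    using inj smooth_on_cylinder_map[OF \<psi>W] \<psi>(1) by (simp add: open_Times)
  moreover have "x \<in> ?\<chi> ` (UNIV \<times> W)" unfolding im using xW by (cases x) auto
  ultimately show "\<exists>(W::(real \<times> 'm) set) \<psi>. local_parametrization (UNIV \<times> M) W \<psi> \<and> x \<in> \<psi> ` W"
    by blast
qed

section \<open>Curves and tangent vectors\<close>

lemma curve_throughE:
  assumes "curve_through M p v \<gamma>"
  obtains e where "e > 0" "smooth_on {-e<..<e} \<gamma>" "\<And>r. r \<in> {-e<..<e} \<Longrightarrow> \<gamma> r \<in> M"
    "\<gamma> 0 = p" "(\<gamma> has_vector_derivative v) (at 0)"
proof -
  obtain e where "e > 0" "smooth_on {-e<..<e} \<gamma>" "\<gamma> ` {-e<..<e} \<subseteq> M"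
    using assms unfolding curve_through_def by (elim conjE exE)
  moreover have "\<gamma> 0 = p" "(\<gamma> has_vector_derivative v) (at 0)"
    using assms unfolding curve_through_def by simp_all
  ultimately show ?thesis by (intro that[of e]) auto
qed

lemma curve_throughI:
  assumes "e > 0" "smooth_on {-e<..<e} \<gamma>" "\<And>r. r \<in> {-e<..<e} \<Longrightarrow> \<gamma> r \<in> M"
    "\<gamma> 0 = p" "(\<gamma> has_vector_derivative v) (at 0)"
  shows "curve_through M p v \<gamma>"
  unfolding curve_through_def using assms by (intro conjI exI[of _ e]) auto

lemma curve_through_base: "curve_through M p v \<gamma> \<Longrightarrow> p \<in> M"
  by (erule curve_throughE) force

text \<open>A curve stays in the domain of a local extension \<open>g\<close> for a short time, so \<open>f \<circ> \<gamma>\<close> can be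
  differentiated through \<open>g\<close>. The velocity depends on \<open>\<gamma>\<close> only through \<open>v\<close>, which makes
  \<^const>\<open>differential_on\<close> meaningful in the next lemma.\<close>

lemma curve_through_chain:
  fixes f g :: "'a::euclidean_space \<Rightarrow> 'b::real_normed_vector"
  assumes \<gamma>: "curve_through M p v \<gamma>" and g: "(g has_derivative g') (at p)"
    and U: "open U" "p \<in> U" "\<And>x. x \<in> M \<Longrightarrow> x \<in> U \<Longrightarrow> g x = f x"
  shows "((\<lambda>r. f (\<gamma> r)) has_vector_derivative g' v) (at 0)"
proof -
  obtain e where e: "e > 0" "smooth_on {-e<..<e} \<gamma>" "\<And>r. r \<in> {-e<..<e} \<Longrightarrow> \<gamma> r \<in> M"
    and 0: "\<gamma> 0 = p" and d: "(\<gamma> has_vector_derivative v) (at 0)"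
    by (rule curve_throughE[OF \<gamma>]) (rule that)
  let ?I = "{-e<..<e} \<inter> \<gamma> -` U"
  have o: "open ?I"
    by (rule continuous_open_preimage[OF smooth_on_imp_continuous_on[OF e(2)] _ U(1)]) simp
  have "(\<gamma> has_derivative (\<lambda>r. r *\<^sub>R v)) (at 0)" using d by (simp add: has_vector_derivative_def)
  moreover have "(g has_derivative g') (at (\<gamma> 0))" using g 0 by simp
  ultimately have "((\<lambda>r. g (\<gamma> r)) has_derivative (\<lambda>r. g' (r *\<^sub>R v))) (at 0)"
    by (rule has_derivative_compose)
  then have 1: "((\<lambda>r. g (\<gamma> r)) has_vector_derivative g' v) (at 0)"
    by (simp add: has_vector_derivative_def linear_scale[OF has_derivative_linear[OF g]])
  have 2: "0 \<in> ?I" using e(1) 0 U(2) by simp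
  have 3: "g (\<gamma> r) = f (\<gamma> r)" if "r \<in> ?I" for r
    by (rule U(3)[OF e(3)]) (use that in simp_all)
  show ?thesis
    by (rule has_vector_derivative_transform_within_open[OF 1 o 2 3])
qed

lemma differential_on_curve:
  fixes f :: "'a::euclidean_space \<Rightarrow> 'b::real_normed_vector"
  assumes f: "smooth_on M f" and \<gamma>: "curve_through M p v \<gamma>"
    and w: "((\<lambda>r. f (\<gamma> r)) has_vector_derivative w) (at 0)"
  shows "differential_on M f p v = w"
proof -
  have "p \<in> M" by (rule curve_through_base[OF \<gamma>])
  obtain U g where U: "open U" "p \<in> U" "\<And>k. Ck_on k U g" "\<And>x. x \<in> M \<Longrightarrow> x \<in> U \<Longrightarrow> g x = f x"
    by (rule smooth_on_extension[OF f \<open>p \<in> M\<close>]) (rule that)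
  note chain = curve_through_chain[OF _ Ck_on_has_derivative[OF U(3,2)] U(1,2,4)]
  have eq: "w = frechet_derivative g (at p) v"
    using vector_derivative_unique_at[OF w chain[OF \<gamma>]] .
  show ?thesis
    unfolding differential_on_def
  proof (rule the_equality)
    show "\<forall>\<gamma>. curve_through M p v \<gamma> \<longrightarrow> ((f \<circ> \<gamma>) has_vector_derivative w) (at 0)"
      proof (intro allI impI)
      fix \<gamma>' assume "curve_through M p v \<gamma>'"
      from chain[OF this] show "((f \<circ> \<gamma>') has_vector_derivative w) (at 0)"
        by (simp add: comp_def eq)
    qed
    fix w' assume "\<forall>\<gamma>. curve_through M p v \<gamma> \<longrightarrow> ((f \<circ> \<gamma>) has_vector_derivative w') (at 0)"
    then have "((\<lambda>r. f (\<gamma> r)) has_vector_derivative w') (at 0)" using \<gamma> by (simp add: comp_def)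
    then show "w' = w" using w by (rule vector_derivative_unique_at)
  qed
qed

lemma curve_through_image:
  fixes f :: "'a::euclidean_space \<Rightarrow> 'b::euclidean_space"
  assumes f: "smooth_on M f" "f ` M \<subseteq> N" and \<gamma>: "curve_through M p v \<gamma>"
    and w: "((\<lambda>r. f (\<gamma> r)) has_vector_derivative w) (at 0)"
  shows "curve_through N (f p) w (\<lambda>r. f (\<gamma> r))"
proof -
  obtain e where e: "e > 0" "smooth_on {-e<..<e} \<gamma>" "\<And>r. r \<in> {-e<..<e} \<Longrightarrow> \<gamma> r \<in> M"
    and 0: "\<gamma> 0 = p" "(\<gamma> has_vector_derivative v) (at 0)"
    by (rule curve_throughE[OF \<gamma>]) (rule that)
  have "smooth_on {-e<..<e} (\<lambda>r. f (\<gamma> r))"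
    by (rule smooth_on_compose[OF e(2) f(1)]) (use e(3) in blast)
  then show ?thesis
    by (rule curve_throughI[OF e(1) _ _ _ w]) (use e(3) f(2) 0(1) in auto)
qed

lemma curve_through_smooth_image:
  fixes f :: "'a::euclidean_space \<Rightarrow> 'b::euclidean_space"
  assumes f: "smooth_on M f" "f ` M \<subseteq> N" and \<gamma>: "curve_through M p v \<gamma>"
  obtains w where "curve_through N (f p) w (\<lambda>r. f (\<gamma> r))"
proof -
  obtain U g where U: "open U" "p \<in> U" "\<And>k. Ck_on k U g" "\<And>x. x \<in> M \<Longrightarrow> x \<in> U \<Longrightarrow> g x = f x"
    by (rule smooth_on_extension[OF f(1) curve_through_base[OF \<gamma>]]) (rule that)
  show ?thesis
    by (rule that[OF curve_through_image[OF f \<gamma>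
            curve_through_chain[OF \<gamma> Ck_on_has_derivative[OF U(3,2)] U(1,2,4)]]])
qed

lemma curve_through_line:
  fixes \<psi> :: "'m::euclidean_space \<Rightarrow> 'a::euclidean_space"
  assumes "open W" "w \<in> W" "\<And>k. Ck_on k W \<psi>" "\<psi> ` W \<subseteq> M"
  shows "curve_through M (\<psi> w) (frechet_derivative \<psi> (at w) v) (\<lambda>r. \<psi> (w + r *\<^sub>R v))"
proof -
  obtain e where e: "e > 0" "ball w e \<subseteq> W" using assms(1,2) openE by blast
  let ?d = "e / (norm v + 1)" and ?l = "\<lambda>r::real. w + r *\<^sub>R v"
  have n: "norm v + 1 > 0" by (simp add: add_nonneg_pos)
  then have d: "?d > 0" using e by simp
  have l: "?l ` {-?d<..<?d} \<subseteq> W"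
  proof
    fix x assume "x \<in> ?l ` {-?d<..<?d}"
    then obtain r where "r \<in> {-?d<..<?d}" and x: "x = w + r *\<^sub>R v" by blast
    then have r: "\<bar>r\<bar> < ?d" by (simp add: abs_less_iff)
    have "\<bar>r\<bar> * norm v \<le> \<bar>r\<bar> * (norm v + 1)" by (intro mult_left_mono) auto
    also have "\<dots> < e" using r n by (simp add: pos_less_divide_eq)
    finally show "x \<in> W" using x by (intro subsetD[OF e(2)]) (simp add: dist_norm)
  qed
  have "Ck_on k UNIV ?l" for k
    by (rule Ck_on_add[OF open_UNIV Ck_on_const[OF open_UNIV]
          Ck_on_bounded_linear[OF open_UNIV bounded_linear_scaleR_left]])
  then have "smooth_on {-?d<..<?d} ?l" by (intro smooth_on_Ck[OF open_UNIV]) auto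
  moreover have "smooth_on W \<psi>" using assms(1,3) by (simp add: smooth_on_open_iff)
  ultimately have sm: "smooth_on {-?d<..<?d} (\<lambda>r. \<psi> (?l r))" using l by (rule smooth_on_compose)
  have l': "(?l has_derivative (\<lambda>r. r *\<^sub>R v)) (at 0)" by (auto intro!: derivative_eq_intros)
  have D: "(\<psi> has_derivative frechet_derivative \<psi> (at w)) (at w)"
    by (rule Ck_on_has_derivative[OF assms(3,2)])
  then have "(\<psi> has_derivative frechet_derivative \<psi> (at w)) (at (?l 0))" by simp
  from has_derivative_compose[OF l' this]
  have vd: "((\<lambda>r. \<psi> (?l r)) has_vector_derivative frechet_derivative \<psi> (at w) v) (at 0)"
    by (simp add: has_vector_derivative_def linear_scale[OF has_derivative_linear[OF D]])
  show ?thesis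
  proof (rule curve_throughI[OF d sm _ _ vd])
    fix r assume "r \<in> {-?d<..<?d}"
    then have "?l r \<in> W" using l by blast
    then show "\<psi> (?l r) \<in> M" using assms(4) by blast
  qed simp
qed

text \<open>With \<open>k\<close> a local inverse of \<open>\<psi>\<close>, a curve \<open>\<gamma>\<close> in \<open>M\<close> equals \<open>\<psi> \<circ> k \<circ> \<gamma>\<close>
  for small times, so the chain rule exhibits its velocity as a value of the derivative of \<open>\<psi>\<close>.\<close>

lemma tangent_space_parametrization:
  assumes par: "local_parametrization M W \<psi>" and w: "w \<in> W" and v: "v \<in> tangent_space M (\<psi> w)"
  obtains V where "v = frechet_derivative \<psi> (at w) V"
proof -
  obtain \<gamma> where \<gamma>: "curve_through M (\<psi> w) v \<gamma>" using v unfolding tangent_space_def by blast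
  note \<psi> = local_parametrization_smooth[OF par]
  obtain U k where k: "open U" "\<psi> w \<in> U" "\<And>n. Ck_on n U k"
    "\<And>x. x \<in> M \<Longrightarrow> x \<in> U \<Longrightarrow> k x \<in> W \<and> \<psi> (k x) = x"
    "\<And>w. w \<in> W \<Longrightarrow> \<psi> w \<in> U \<Longrightarrow> k (\<psi> w) = w"
    by (rule local_parametrization_inverse[OF par w]) (rule that)
  have kw: "k (\<psi> w) = w" using k(5)[OF w k(2)] .
  have "(\<psi> has_derivative frechet_derivative \<psi> (at w)) (at (k (\<psi> w)))"
    unfolding kw by (rule Ck_on_has_derivative[OF \<psi>(3) w])
  from has_derivative_compose[OF Ck_on_has_derivative[OF k(3,2)] this]
  have "((\<lambda>x. \<psi> (k x)) has_derivative
      (\<lambda>v. frechet_derivative \<psi> (at w) (frechet_derivative k (at (\<psi> w)) v))) (at (\<psi> w))" .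
  from curve_through_chain[OF \<gamma> this k(1,2), of "\<lambda>x. x"]
  have "(\<gamma> has_vector_derivative frechet_derivative \<psi> (at w) (frechet_derivative k (at (\<psi> w)) v)) (at 0)"
    using k(4) by simp
  moreover have "(\<gamma> has_vector_derivative v) (at 0)" by (rule curve_throughE[OF \<gamma>])
  ultimately have "frechet_derivative \<psi> (at w) (frechet_derivative k (at (\<psi> w)) v) = v"
    by (rule vector_derivative_unique_at)
  then show ?thesis by (rule that[OF sym])
qed

section \<open>Exact Lagrangian submanifolds\<close>

text \<open>This is \<open>d \<circ> d = 0\<close> on \<open>M\<close>. In a parametrization \<open>\<psi>\<close> exactness reads
  \<open>\<theta>(\<psi> w)(D\<psi>(w) V) = D(h \<circ> \<psi>)(w) V\<close>. Differentiating in direction \<open>U\<close> and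
  antisymmetrising in \<open>U\<close> and \<open>V\<close> leaves exactly \<open>d\<theta>(u, v)\<close> on the left, since the second
  derivatives of \<open>\<psi>\<close> and of \<open>h \<circ> \<psi>\<close> are symmetric.\<close>

lemma exact_form_is_closed:
  fixes M :: "'a::euclidean_space set" and \<theta> :: "'a \<Rightarrow> 'a \<Rightarrow> real"
  assumes M: "smooth_submanifold TYPE('m::euclidean_space) M" and h: "smooth_on M h"
    and \<theta>: "\<And>q. linear (\<theta> q)" "\<And>q v. (\<lambda>q. \<theta> q v) differentiable (at q)"
    and exact: "\<And>q v. q \<in> M \<Longrightarrow> v \<in> tangent_space M q \<Longrightarrow> \<theta> q v = differential_on M h q v"
    and p: "p \<in> M" and uv: "u \<in> tangent_space M p" "v \<in> tangent_space M p"
  shows "exterior_derivative \<theta> p u v = 0"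
proof -
  obtain W :: "'m set" and \<psi> where par: "local_parametrization M W \<psi>" and "p \<in> \<psi> ` W"
    using M p unfolding smooth_submanifold_def by blast
  then obtain w0 where w0: "w0 \<in> W" "\<psi> w0 = p" by blast
  note \<psi> = local_parametrization_smooth[OF par]
  let ?D = "\<lambda>V w. frechet_derivative \<psi> (at w) V" and ?h = "\<lambda>w. h (\<psi> w)"
  let ?d\<theta> = "\<lambda>v. frechet_derivative (\<lambda>q. \<theta> q v) (at p)"
  obtain U where U: "u = ?D U w0"
    by (rule tangent_space_parametrization[OF par w0(1), unfolded w0(2), OF uv(1)])
  obtain V where V: "v = ?D V w0"
    by (rule tangent_space_parametrization[OF par w0(1), unfolded w0(2), OF uv(2)])
  have "smooth_on W \<psi>" using \<psi>(1,3) by (simp add: smooth_on_open_iff)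
  then have hs: "smooth_on W ?h" by (rule smooth_on_compose[OF _ h \<psi>(4)])
  then have hC: "Ck_on k W ?h" for k using \<psi>(1) by (simp add: smooth_on_open_iff)
  have pull: "\<theta> (\<psi> w) (?D V w) = frechet_derivative ?h (at w) V" if w: "w \<in> W" for w V
  proof -
    have cur: "curve_through M (\<psi> w) (?D V w) (\<lambda>r. \<psi> (w + r *\<^sub>R V))"
      by (rule curve_through_line[OF \<psi>(1) w \<psi>(3,4)])
    have "curve_through UNIV (?h w) (frechet_derivative ?h (at w) V) (\<lambda>r. ?h (w + r *\<^sub>R V))"
      by (rule curve_through_line[OF \<psi>(1) w hC]) simp
    then have "((\<lambda>r. h (\<psi> (w + r *\<^sub>R V))) has_vector_derivative frechet_derivative ?h (at w) V) (at 0)"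
      by (rule curve_throughE)
    then have "differential_on M h (\<psi> w) (?D V w) = frechet_derivative ?h (at w) V"
      by (rule differential_on_curve[OF h cur])
    moreover have "\<psi> w \<in> M" using w \<psi>(4) by blast
    moreover have "?D V w \<in> tangent_space M (\<psi> w)" using cur unfolding tangent_space_def by blast
    ultimately show ?thesis using exact by simp
  qed
  have key: "?d\<theta> (?D V w0) (?D U w0) + \<theta> p (frechet_derivative (?D V) (at w0) U)
      = frechet_derivative (\<lambda>w. frechet_derivative ?h (at w) V) (at w0) U" for U V
  proof -
    let ?X = "?D V"
    have X: "(?X has_derivative frechet_derivative ?X (at w0)) (at w0)"
      using Ck_on_has_derivative[of 0 W ?X] \<psi>(3)[of "Suc (Suc 0)"] w0(1) by simp
    have th: "((\<lambda>q. \<theta> q b) has_derivative ?d\<theta> b) (at (\<psi> w0))" for b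
      using \<theta>(2) w0(2) by (simp add: frechet_derivative_works)
    have th\<psi>: "((\<lambda>w. \<theta> (\<psi> w) b) has_derivative (\<lambda>U. ?d\<theta> b (?D U w0))) (at w0)" for b
      by (rule has_derivative_compose[OF Ck_on_has_derivative[OF \<psi>(3) w0(1)] th])
    have expand: "\<theta> q x = (\<Sum>b\<in>Basis. (x \<bullet> b) * \<theta> q b)" for q x
      using linear_basis_expansion[OF \<theta>(1)[of q], of x] by simp
    have d_expand: "?d\<theta> x y = (\<Sum>b\<in>Basis. (x \<bullet> b) * ?d\<theta> b y)" for x y
    proof -
      have "((\<lambda>q. \<Sum>b\<in>Basis. (x \<bullet> b) * \<theta> q b) has_derivative (\<lambda>y. \<Sum>b\<in>Basis. (x \<bullet> b) * ?d\<theta> b y)) (at p)"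
        using th unfolding w0(2) by (intro has_derivative_sum has_derivative_mult_right)
      then have "((\<lambda>q. \<theta> q x) has_derivative (\<lambda>y. \<Sum>b\<in>Basis. (x \<bullet> b) * ?d\<theta> b y)) (at p)"
        by (simp only: expand[of _ x])
      from fun_cong[OF frechet_derivative_at[OF this], of y] show ?thesis by (rule sym)
    qed
    have "((\<lambda>w. \<Sum>b\<in>Basis. (?X w \<bullet> b) * \<theta> (\<psi> w) b) has_derivative
        (\<lambda>U. \<Sum>b\<in>Basis. (?X w0 \<bullet> b) * ?d\<theta> b (?D U w0)
          + (frechet_derivative ?X (at w0) U \<bullet> b) * \<theta> (\<psi> w0) b)) (at w0)"
      by (intro has_derivative_sum has_derivative_mult has_derivative_inner_left X th\<psi>)
    then have "((\<lambda>w. \<theta> (\<psi> w) (?X w)) has_derivative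
        (\<lambda>U. ?d\<theta> (?X w0) (?D U w0) + \<theta> p (frechet_derivative ?X (at w0) U))) (at w0)"
      unfolding sum.distrib by (simp only: expand[symmetric] d_expand[symmetric] w0(2))
    then have "((\<lambda>w. frechet_derivative ?h (at w) V) has_derivative
        (\<lambda>U. ?d\<theta> (?X w0) (?D U w0) + \<theta> p (frechet_derivative ?X (at w0) U))) (at w0)"
      by (rule has_derivative_transform_within_open[OF _ \<psi>(1) w0(1)]) (rule pull)
    from fun_cong[OF frechet_derivative_at[OF this], of U] show ?thesis .
  qed
  have "frechet_derivative (\<lambda>w. frechet_derivative ?h (at w) V) (at w0) U
      = frechet_derivative (\<lambda>w. frechet_derivative ?h (at w) U) (at w0) V"
    by (rule symmetric_second_derivative[OF \<psi>(1) hC w0(1)])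
  moreover have "frechet_derivative (?D V) (at w0) U = frechet_derivative (?D U) (at w0) V"
    by (rule symmetric_second_derivative[OF \<psi>(1,3) w0(1)])
  ultimately have "?d\<theta> v u = ?d\<theta> u v"
    using key[of V U] key[of U V] by (simp add: U V)
  then show ?thesis by (simp add: exterior_derivative_def)
qed

lemma contact_form_eq: "contact_form p v = snd (snd v) - fst (snd p) \<bullet> fst v"
  by (simp add: contact_form_def case_prod_beta inner_vec_def)

lemma liouville_form_eq:
  "liouville_form q v = exp (fst q) * (snd (snd (snd v)) - fst (snd (snd q)) \<bullet> fst (snd v))"
  by (simp add: liouville_form_def contact_form_def case_prod_beta inner_vec_def)

lemma exact_lagrangian_of_primitive:
  fixes L :: "(real \<times> 'n::finite contact_space) set"
  assumes L: "smooth_submanifold TYPE(real \<times> (real^'n)) L" and h: "smooth_on L h"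
    and exact: "\<And>q v. q \<in> L \<Longrightarrow> v \<in> tangent_space L q \<Longrightarrow> liouville_form q v = differential_on L h q v"
  shows "exact_lagrangian L"
proof -
  have "linear (liouville_form q)" for q :: "real \<times> 'n contact_space"
    by (rule linearI) (simp_all add: liouville_form_eq inner_add_right algebra_simps)
  moreover have "(\<lambda>q. liouville_form q v) differentiable (at q)" for q v :: "real \<times> 'n contact_space"
  proof -
    have "((\<lambda>q::real \<times> 'n contact_space. exp (fst q)) has_derivative (\<lambda>u. exp (fst q) * fst u)) (at q)"
      "((\<lambda>q::real \<times> 'n contact_space. fst (snd (snd q)) \<bullet> fst (snd v)) has_derivative
        (\<lambda>u. fst (snd (snd u)) \<bullet> fst (snd v))) (at q)"
      by (auto intro!: derivative_eq_intros)
    then have "(\<lambda>q::real \<times> 'n contact_space. exp (fst q)) differentiable (at q)"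
      "(\<lambda>q::real \<times> 'n contact_space. fst (snd (snd q)) \<bullet> fst (snd v)) differentiable (at q)"
      unfolding differentiable_def by blast+
    then show ?thesis
      unfolding liouville_form_eq
      by (intro differentiable_mult differentiable_diff differentiable_const) auto
  qed
  ultimately have "symplectic_form p u v = 0"
    if "p \<in> L" "u \<in> tangent_space L p" "v \<in> tangent_space L p" for p u v
    unfolding symplectic_form_def by (rule exact_form_is_closed[OF L h _ _ exact that])
  then show ?thesis
    unfolding exact_lagrangian_def lagrangian_def using L h exact by blast
qed

section \<open>A slow smooth step\<close>

text \<open>The functions \<open>x\<^sup>-\<^sup>n e\<^sup>-\<^sup>1\<^sup>/\<^sup>x\<close> extended by zero: a family of continuous functions whose
  span is closed under differentiation, so that smoothness at \<open>0\<close> follows for all members at once.\<close>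

definition flat :: "nat \<Rightarrow> real \<Rightarrow> real" where
  "flat n x = (if x > 0 then inverse x ^ n * exp (- inverse x) else 0)"

lemma flat_tendsto_0: "(flat n \<longlongrightarrow> 0) (at 0)"
proof -
  have "((\<lambda>u::real. u ^ n / exp u) \<longlongrightarrow> 0) at_top"
    by (rule tendsto_power_div_exp_0)
  then have "((\<lambda>x::real. inverse x ^ n / exp (inverse x)) \<longlongrightarrow> 0) (at_right 0)"
    by (rule filterlim_compose[OF _ filterlim_inverse_at_top_right])
  then have "(flat n \<longlongrightarrow> 0) (at_right 0)"
    by (rule Lim_transform_eventually)
      (auto simp: flat_def exp_minus divide_inverse eventually_at_right_less intro: eventually_mono[OF eventually_at_right_less])
  moreover have "(flat n \<longlongrightarrow> 0) (at_left 0)"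
    by (rule tendsto_eventually) (auto simp: flat_def eventually_at_left_field intro: exI[of _ "-1"])
  ultimately show ?thesis by (simp add: filterlim_split_at)
qed

lemma flat_has_derivative:
  "(flat n has_real_derivative (flat (n + 2) x - real n * flat (n + 1) x)) (at x)"
proof -
  consider "x < 0" | "x = 0" | "x > 0" by linarith
  then show ?thesis
  proof cases
    case 1
    have "((\<lambda>x. 0) has_real_derivative (flat (n + 2) x - real n * flat (n + 1) x)) (at x)"
      using 1 by (simp add: flat_def)
    then show ?thesis
      by (rule has_field_derivative_transform_within_open[where S = "{..<0}"]) (use 1 in \<open>auto simp: flat_def\<close>)
  next
    case 2
    have "((\<lambda>h. (flat n (0 + h) - flat n 0) / h) \<longlongrightarrow> 0) (at 0)"
      by (rule Lim_transform_eventually[OF flat_tendsto_0[of "n + 1"]])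
        (auto simp: flat_def eventually_at_filter field_simps)
    then show ?thesis using 2 by (simp add: DERIV_def flat_def)
  next
    case 3
    have d: "((\<lambda>x. inverse x ^ n * exp (- inverse x)) has_real_derivative
        (real n * (- (inverse x * inverse x)) * inverse x ^ (n - 1)) * exp (- inverse x)
        + exp (- inverse x) * (inverse x * inverse x) * inverse x ^ n) (at x)"
      using 3 by (auto intro!: derivative_eq_intros simp: power2_eq_square)
    have e: "real n * (- (inverse x * inverse x)) * inverse x ^ (n - 1) = - real n * inverse x ^ (n + 1)"
      by (cases n) (simp_all add: algebra_simps)
    have "(real n * (- (inverse x * inverse x)) * inverse x ^ (n - 1)) * exp (- inverse x)
        + exp (- inverse x) * (inverse x * inverse x) * inverse x ^ n
        = flat (n + 2) x - real n * flat (n + 1) x"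
      unfolding e using 3 by (simp add: flat_def algebra_simps)
    with d have "((\<lambda>x. inverse x ^ n * exp (- inverse x)) has_real_derivative
        flat (n + 2) x - real n * flat (n + 1) x) (at x)" by simp
    then show ?thesis
      by (rule has_field_derivative_transform_within_open[where S = "{0<..}"]) (use 3 in \<open>auto simp: flat_def\<close>)
  qed
qed

lemma Ck_on_flat: "Ck_on k UNIV (flat n)"
proof (induction k arbitrary: n)
  case 0
  have "isCont (flat n) x" for x by (rule DERIV_isCont[OF flat_has_derivative])
  then show ?case by (simp add: continuous_at_imp_continuous_on)
next
  case (Suc k)
  have "Ck_on k UNIV (\<lambda>x. (flat (n + 2) x + (- real n) * flat (n + 1) x) * v)" for v
    by (rule Ck_on_linear_compose[OF bounded_linear_mult_left open_UNIV
          Ck_on_add[OF open_UNIV Suc.IH Ck_on_linear_compose[OF bounded_linear_mult_right open_UNIV Suc.IH]]])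
  then have 1: "Ck_on k UNIV (\<lambda>x. (flat (n + 2) x - real n * flat (n + 1) x) * v)" for v
    by simp
  show ?case
    by (rule Ck_on_SucI[OF open_UNIV _ 1]) (rule flat_has_derivative[unfolded has_field_derivative_def])
qed

lemma smooth_step_exists:
  obtains \<sigma> :: "real \<Rightarrow> real" where "\<And>k. Ck_on k UNIV \<sigma>" "\<And>t. \<sigma> t \<in> {0..1}"
    "\<And>t. t \<le> 0 \<Longrightarrow> \<sigma> t = 0" "\<And>t. t \<ge> 1 \<Longrightarrow> \<sigma> t = 1"
proof -
  let ?d = "\<lambda>t. flat 0 t + flat 0 (1 - t)"
  have nn: "flat 0 t \<ge> 0" for t by (simp add: flat_def)
  have pos: "?d t > 0" for t
  proof (cases "t > 0")
    case True
    then have "flat 0 t > 0" by (simp add: flat_def)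
    then show ?thesis using nn[of "1 - t"] by linarith
  next
    case False
    then have "flat 0 (1 - t) > 0" by (simp add: flat_def)
    then show ?thesis using nn[of t] by linarith
  qed
  have "Ck_on k UNIV (\<lambda>t::real. 1 + - t)" for k
    by (rule Ck_on_add[OF open_UNIV Ck_on_const[OF open_UNIV]
          Ck_on_bounded_linear[OF open_UNIV bounded_linear_minus[OF bounded_linear_ident]]])
  then have refl: "Ck_on k UNIV (\<lambda>t::real. 1 - t)" for k by simp
  have d: "Ck_on k UNIV ?d" for k
    by (rule Ck_on_add[OF open_UNIV Ck_on_flat Ck_on_compose[OF open_UNIV open_UNIV _ refl Ck_on_flat]]) simp
  have "Ck_on k UNIV (\<lambda>t. inverse (?d t))" for k
    by (rule Ck_on_compose[OF open_UNIV _ _ d Ck_on_inverse])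
      (use pos in \<open>auto simp: open_Collect_neq less_imp_neq[symmetric]\<close>)
  then have "Ck_on k UNIV (\<lambda>t. flat 0 t * inverse (?d t))" for k
    by (rule Ck_on_bilinear[OF bounded_bilinear_mult open_UNIV Ck_on_flat])
  moreover have "flat 0 t * inverse (?d t) \<in> {0..1}" for t
    using nn[of t] nn[of "1 - t"] pos[of t] by (simp add: divide_inverse[symmetric])
  moreover have "flat 0 t * inverse (?d t) = 0" if "t \<le> 0" for t using that by (simp add: flat_def)
  moreover have "flat 0 t * inverse (?d t) = 1" if "t \<ge> 1" for t
    using that pos[of t] by (simp add: flat_def)
  ultimately show ?thesis by (rule that)
qed

text \<open>The derivative is again constant (zero) outside the unit interval, so that the lemma can be
  iterated: applied to a step and then to its derivative it makes both of them Lipschitz.\<close>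

lemma derivative_of_function_constant_outside:
  fixes f :: "real \<Rightarrow> real"
  assumes f: "\<And>k. Ck_on k UNIV f" and const: "\<And>t. t \<le> 0 \<Longrightarrow> f t = a" "\<And>t. t \<ge> 1 \<Longrightarrow> f t = b"
  obtains f' B where "\<And>k. Ck_on k UNIV f'" "\<And>t. (f has_real_derivative f' t) (at t)"
    "\<And>t. t \<le> 0 \<Longrightarrow> f' t = 0" "\<And>t. t \<ge> 1 \<Longrightarrow> f' t = 0" "B > 0" "\<And>t. \<bar>f' t\<bar> \<le> B"
    "\<And>s t. \<bar>f s - f t\<bar> \<le> B * \<bar>s - t\<bar>"
proof -
  define f' where "f' t = frechet_derivative f (at t) 1" for t
  have C: "Ck_on k UNIV f'" for k
    using f[of "Suc k"] unfolding f'_def by simp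
  have D: "(f has_real_derivative f' t) (at t)" for t
  proof -
    have fd: "(f has_derivative frechet_derivative f (at t)) (at t)"
      by (rule Ck_on_has_derivative[OF f]) simp
    have "frechet_derivative f (at t) x = f' t * x" for x
      using linear_scale[OF has_derivative_linear[OF fd], of x 1] by (simp add: f'_def)
    then have "frechet_derivative f (at t) = (*) (f' t)" by (rule ext)
    then show ?thesis using fd by (simp add: has_field_derivative_def)
  qed
  have zero: "f' t = 0" if "t < 0 \<or> t > 1" for t
  proof -
    let ?S = "if t < 0 then {..<0} else {1<..}" and ?c = "if t < 0 then a else b"
    have "(f has_real_derivative 0) (at t)"
      by (rule has_field_derivative_transform_within_open[of "\<lambda>_. ?c" _ _ ?S])
        (use that const in \<open>auto split: if_splits\<close>)
    then show ?thesis using D DERIV_unique by blast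
  qed
  have cont: "continuous_on UNIV f'" using C[of 0] by simp
  have zero': "f' t = 0" if "t \<le> 0 \<or> t \<ge> 1" for t
  proof -
    have "closed {t. f' t = 0}"
      using continuous_closed_preimage_constant[OF cont, of 0] by simp
    moreover have "{..<0} \<subseteq> {t. f' t = 0}" "{1<..} \<subseteq> {t. f' t = 0}" using zero by auto
    ultimately have "closure {..<0} \<subseteq> {t. f' t = 0}" "closure {1<..} \<subseteq> {t. f' t = 0}"
      by (auto simp: closure_minimal simp del: closure_lessThan closure_greaterThan)
    then show ?thesis using that by auto
  qed
  have "compact (f' ` {0..1})"
    by (rule compact_continuous_image[OF continuous_on_subset[OF cont]]) auto
  then obtain B where B: "B > 0" "\<And>x. x \<in> f' ` {0..1} \<Longrightarrow> norm x \<le> B"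
    using compact_imp_bounded[of "f' ` {0..1}"] unfolding bounded_pos by auto
  have bound: "\<bar>f' t\<bar> \<le> B" for t
    using B zero'[of t] by (cases "t \<in> {0..1}") auto
  have lip: "\<bar>f s - f t\<bar> \<le> B * \<bar>s - t\<bar>" for s t
    using field_differentiable_bound[of UNIV f f' B s t] D bound by simp
  show ?thesis by (rule that[OF C D _ _ B(1) bound lip]) (use zero' in auto)
qed

text \<open>Running a fixed step \<open>N \<ge> 1\<close> times more slowly divides its speed by \<open>N\<close> and does not increase
  the Lipschitz constants.\<close>

lemma slow_smooth_step:
  fixes \<epsilon> :: real
  assumes "\<epsilon> > 0"
  obtains T s s' B where "T > 0" "\<And>k. Ck_on k UNIV s" "\<And>k. Ck_on k UNIV s'"
    "\<And>t. (s has_real_derivative s' t) (at t)" "\<And>t. s t \<in> {0..1}" "\<And>t. \<bar>s' t\<bar> \<le> \<epsilon>"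
    "\<And>t. t \<le> - T \<Longrightarrow> s t = 0 \<and> s' t = 0" "\<And>t. t \<ge> T \<Longrightarrow> s t = 1 \<and> s' t = 0"
    "B > 0" "\<And>t u. \<bar>s t - s u\<bar> \<le> B * \<bar>t - u\<bar>" "\<And>t u. \<bar>s' t - s' u\<bar> \<le> B * \<bar>t - u\<bar>"
proof -
  obtain \<sigma> :: "real \<Rightarrow> real" where \<sigma>: "\<And>k. Ck_on k UNIV \<sigma>" "\<And>t. \<sigma> t \<in> {0..1}"
    "\<And>t. t \<le> 0 \<Longrightarrow> \<sigma> t = 0" "\<And>t. t \<ge> 1 \<Longrightarrow> \<sigma> t = 1"
    by (rule smooth_step_exists) (rule that)
  obtain \<sigma>' B1 where \<sigma>': "\<And>k. Ck_on k UNIV \<sigma>'" "\<And>t. (\<sigma> has_real_derivative \<sigma>' t) (at t)"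
    "\<And>t. t \<le> 0 \<Longrightarrow> \<sigma>' t = 0" "\<And>t. t \<ge> 1 \<Longrightarrow> \<sigma>' t = 0" "B1 > 0" "\<And>t. \<bar>\<sigma>' t\<bar> \<le> B1"
    "\<And>s t. \<bar>\<sigma> s - \<sigma> t\<bar> \<le> B1 * \<bar>s - t\<bar>"
    by (rule derivative_of_function_constant_outside[OF \<sigma>(1,3,4)]) (assumption+, rule that)
  obtain \<sigma>'' B2 where \<sigma>'': "\<And>k. Ck_on k UNIV \<sigma>''" "\<And>t. (\<sigma>' has_real_derivative \<sigma>'' t) (at t)"
    "\<And>t. t \<le> 0 \<Longrightarrow> \<sigma>'' t = 0" "\<And>t. t \<ge> 1 \<Longrightarrow> \<sigma>'' t = 0" "B2 > 0" "\<And>t. \<bar>\<sigma>'' t\<bar> \<le> B2"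
    "\<And>s t. \<bar>\<sigma>' s - \<sigma>' t\<bar> \<le> B2 * \<bar>s - t\<bar>"
    by (rule derivative_of_function_constant_outside[OF \<sigma>'(1,3,4)]) (assumption+, rule that)
  define N where "N = max 1 (B1 / \<epsilon>)"
  have N: "N \<ge> 1" "B1 \<le> \<epsilon> * N"
  proof -
    show "N \<ge> 1" by (simp add: N_def)
    have "B1 / \<epsilon> \<le> N" by (simp add: N_def)
    then show "B1 \<le> \<epsilon> * N" using assms by (simp add: field_simps)
  qed
  \<comment> \<open>maps \<open>[-N, N]\<close> onto \<open>[-1/2, 3/2]\<close>, so that the step is constant near both ends\<close>
  define l where "l t = 1 / 2 + (1 / N) * t" for t
  have l: "Ck_on k UNIV l" for k
    unfolding l_def
    by (rule Ck_on_add[OF open_UNIV Ck_on_const[OF open_UNIV]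
          Ck_on_bounded_linear[OF open_UNIV bounded_linear_mult_right]])
  have l_end: "l t \<le> 0" if "t \<le> - N" for t
    using that N(1) by (simp add: l_def field_simps)
  have l_end': "l t \<ge> 1" if "t \<ge> N" for t
    using that N(1) by (simp add: l_def field_simps)
  have l_lip: "\<bar>l t - l u\<bar> \<le> \<bar>t - u\<bar>" for t u
  proof -
    have "\<bar>l t - l u\<bar> = (1 / N) * \<bar>t - u\<bar>"
      using N(1) by (simp add: l_def abs_mult flip: right_diff_distrib diff_divide_distrib)
    also have "\<dots> \<le> 1 * \<bar>t - u\<bar>" using N(1) by (intro mult_right_mono) auto
    finally show ?thesis by simp
  qed
  let ?s = "\<lambda>t. \<sigma> (l t)" and ?s' = "\<lambda>t. (1 / N) * \<sigma>' (l t)"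
  have lip: "\<bar>f (l t) - f (l u)\<bar> \<le> (B1 + B2) * \<bar>t - u\<bar>"
    if "\<And>s t. \<bar>f s - f t\<bar> \<le> B * \<bar>s - t\<bar>" "B \<le> B1 + B2" for f :: "real \<Rightarrow> real" and B t u
  proof -
    have "\<bar>f (l t) - f (l u)\<bar> \<le> B * \<bar>l t - l u\<bar>" by (rule that)
    also have "\<dots> \<le> (B1 + B2) * \<bar>t - u\<bar>"
      by (rule mult_mono) (use that(2) l_lip \<sigma>'(5) \<sigma>''(5) in auto)
    finally show ?thesis .
  qed
  show ?thesis
  proof (rule that[of N ?s ?s' "B1 + B2"])
    show "Ck_on k UNIV ?s" for k by (rule Ck_on_compose[OF open_UNIV open_UNIV _ l \<sigma>(1)]) simp
    show "Ck_on k UNIV ?s'" for k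
      by (rule Ck_on_linear_compose[OF bounded_linear_mult_right open_UNIV
            Ck_on_compose[OF open_UNIV open_UNIV _ l \<sigma>'(1)]]) simp
    show "(?s has_real_derivative ?s' t) (at t)" for t
    proof -
      have "(l has_real_derivative 1 / N) (at t)"
        unfolding l_def using N(1) by (auto intro!: derivative_eq_intros)
      from DERIV_chain2[OF \<sigma>'(2) this] show ?thesis by (simp add: mult.commute)
    qed
    show "\<bar>?s' t\<bar> \<le> \<epsilon>" for t
    proof -
      have "\<bar>\<sigma>' (l t)\<bar> \<le> \<epsilon> * N" using \<sigma>'(6)[of "l t"] N(2) by linarith
      then show ?thesis using N(1) by (simp add: abs_mult field_simps)
    qed
    show "\<bar>?s t - ?s u\<bar> \<le> (B1 + B2) * \<bar>t - u\<bar>" for t u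
      by (rule lip[OF \<sigma>'(7)]) (use \<sigma>''(5) in simp)
    show "\<bar>?s' t - ?s' u\<bar> \<le> (B1 + B2) * \<bar>t - u\<bar>" for t u
    proof -
      have "\<bar>?s' t - ?s' u\<bar> = (1 / N) * \<bar>\<sigma>' (l t) - \<sigma>' (l u)\<bar>"
        using N(1) by (simp add: abs_mult flip: right_diff_distrib diff_divide_distrib)
      also have "\<dots> \<le> 1 * \<bar>\<sigma>' (l t) - \<sigma>' (l u)\<bar>" using N(1) by (intro mult_right_mono) auto
      also have "\<dots> \<le> (B1 + B2) * \<bar>t - u\<bar>"
        using lip[OF \<sigma>''(7), of t u] \<sigma>'(5) by simp
      finally show ?thesis .
    qed
  qed (use N(1) \<sigma>(2,3,4) \<sigma>'(3,4,5) \<sigma>''(5) l_end l_end' in auto)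
qed

section \<open>Uniform estimates on compact sets\<close>

lemma compact_uniform_factor:
  fixes a b :: "'a::topological_space \<Rightarrow> real"
  assumes K: "compact K" and a: "\<And>x. x \<in> K \<Longrightarrow> a x \<ge> 0"
    and local: "\<And>x. x \<in> K \<Longrightarrow> \<exists>U m. open U \<and> x \<in> U \<and> m > 0 \<and> (\<forall>y\<in>K \<inter> U. m * a y \<le> b y)"
  obtains m where "m > 0" "\<And>y. y \<in> K \<Longrightarrow> m * a y \<le> b y"
proof -
  let ?P = "\<lambda>x U m. open U \<and> x \<in> U \<and> m > (0::real) \<and> (\<forall>y\<in>K \<inter> U. m * a y \<le> b y)"
  have "\<forall>x\<in>K. \<exists>f. ?P x (fst f) (snd f)"
  proof
    fix x assume "x \<in> K"
    from local[OF this] obtain U m where "?P x U m" by (elim exE)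
    then have "?P x (fst (U, m)) (snd (U, m))" by simp
    then show "\<exists>f. ?P x (fst f) (snd f)" by (rule exI)
  qed
  from bchoice[OF this] obtain f where f: "\<forall>x\<in>K. ?P x (fst (f x)) (snd (f x))" ..
  define U m where "U x = fst (f x)" and "m x = snd (f x)" for x
  have Um: "open (U x)" "x \<in> U x" "m x > 0" "\<forall>y\<in>K \<inter> U x. m x * a y \<le> b y" if "x \<in> K" for x
    using f[rule_format, OF that] by (simp_all add: U_def m_def)
  have cover: "K \<subseteq> (\<Union>x\<in>K. U x)" using Um(2) by blast
  obtain D where D: "D \<subseteq> K" "finite D" "K \<subseteq> (\<Union>x\<in>D. U x)"
    by (rule compactE_image[OF K Um(1) cover]) (assumption, rule that)
  let ?m = "Min (insert 1 (m ` D))"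
  show ?thesis
  proof (rule that[of ?m])
    show "?m > 0" using D(1,2) Um(3) by (subst Min_gr_iff) auto
    fix y assume y: "y \<in> K"
    then obtain x where x: "x \<in> D" "y \<in> U x" using D(3) by blast
    have "?m \<le> m x" using D(2) x(1) by (intro Min_le) auto
    then have "?m * a y \<le> m x * a y" by (rule mult_right_mono[OF _ a[OF y]])
    also have "\<dots> \<le> b y" using Um(4)[of x] D(1) x y by blast
    finally show "?m * a y \<le> b y" .
  qed
qed

lemma compact_diameter_bound:
  assumes "compact (K :: 'a::metric_space set)"
  obtains D where "D > 0" "\<And>x y. x \<in> K \<Longrightarrow> y \<in> K \<Longrightarrow> dist x y \<le> D"
proof -
  have "\<exists>e. \<forall>x\<in>K. \<forall>y\<in>K. dist x y \<le> e"
    using compact_imp_bounded[OF assms] unfolding bounded_two_points .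
  then obtain e where "\<And>x y. x \<in> K \<Longrightarrow> y \<in> K \<Longrightarrow> dist x y \<le> e" by blast
  then show ?thesis by (intro that[of "max 1 e"]) (auto simp: le_max_iff_disj)
qed

text \<open>Near the diagonal of \<open>K \<times> K\<close> the bound is the local Lipschitz property; away from it the
  distance \<open>dist x y\<close> is bounded below while \<open>f\<close> is bounded.\<close>

lemma smooth_on_compact_lipschitz:
  fixes f :: "'a::euclidean_space \<Rightarrow> 'b::real_normed_vector"
  assumes K: "compact K" and f: "smooth_on K f"
  obtains C where "C > 0" "\<And>x y. x \<in> K \<Longrightarrow> y \<in> K \<Longrightarrow> dist (f x) (f y) \<le> C * dist x y"
proof -
  obtain D where D: "D > 0" "\<And>x y. x \<in> f ` K \<Longrightarrow> y \<in> f ` K \<Longrightarrow> dist x y \<le> D"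
    by (rule compact_diameter_bound[OF compact_continuous_image[OF smooth_on_imp_continuous_on[OF f] K]])
      (rule that)
  have local: "\<exists>U m. open U \<and> z \<in> U \<and> m > 0 \<and>
      (\<forall>y\<in>K \<times> K \<inter> U. m * dist (f (fst y)) (f (snd y)) \<le> dist (fst y) (snd y))"
    if "z \<in> K \<times> K" for z
  proof -
    obtain p q where z: "z = (p, q)" by (cases z)
    have pq: "p \<in> K" "q \<in> K" using that by (simp_all add: z)
    show ?thesis
    proof (cases "p = q")
      case True
      obtain U g where U: "open U" "p \<in> U" "\<And>k. Ck_on k U g" "\<And>x. x \<in> K \<Longrightarrow> x \<in> U \<Longrightarrow> g x = f x"
        by (rule smooth_on_extension[OF f pq(1)]) (rule that)
      obtain r C where r: "r > 0" "C > 0" "ball p r \<subseteq> U"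
        "\<And>x y. x \<in> ball p r \<Longrightarrow> y \<in> ball p r \<Longrightarrow> dist (g x) (g y) \<le> C * dist x y"
        by (rule Ck_on_locally_lipschitz[OF U(1) U(3) U(2)]) (rule that)
      have "(1 / C) * dist (f x) (f y) \<le> dist x y"
        if "x \<in> K" "y \<in> K" "x \<in> ball p r" "y \<in> ball p r" for x y
      proof -
        have "dist (f x) (f y) \<le> C * dist x y"
          using r(4)[OF that(3,4)] U(4)[OF that(1)] U(4)[OF that(2)] that(3,4) subsetD[OF r(3)] by simp
        then show ?thesis using r(2) by (simp add: field_simps)
      qed
      then show ?thesis
        unfolding z True[symmetric] using r(1,2)
        by (intro exI[of _ "ball p r \<times> ball p r"] exI[of _ "1 / C"]) (auto simp: open_Times)
    next
      case False
      define d where "d = dist p q"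
      have d: "d > 0" using False by (simp add: d_def)
      have "(d / 2 / D) * dist (f x) (f y) \<le> dist x y"
        if "x \<in> K" "y \<in> K" "x \<in> ball p (d / 4)" "y \<in> ball q (d / 4)" for x y
      proof -
        have "(d / 2 / D) * dist (f x) (f y) \<le> (d / 2 / D) * D"
          using D that(1,2) d by (intro mult_left_mono) auto
        also have "\<dots> = d / 2" using D(1) by simp
        also have "\<dots> \<le> dist x y"
        proof -
          have "d \<le> dist p x + dist x y + dist y q"
            unfolding d_def using dist_triangle[of p q x] dist_triangle[of x q y] by linarith
          then show ?thesis using that(3,4) by (simp add: dist_commute)
        qed
        finally show ?thesis .
      qed
      then show ?thesis
        unfolding z using d D(1)
        by (intro exI[of _ "ball p (d / 4) \<times> ball q (d / 4)"] exI[of _ "d / 2 / D"]) (auto simp: open_Times)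
    qed
  qed
  obtain m where m: "m > 0" "\<And>z. z \<in> K \<times> K \<Longrightarrow> m * dist (f (fst z)) (f (snd z)) \<le> dist (fst z) (snd z)"
    by (rule compact_uniform_factor[OF compact_Times[OF K K] _ local]) (simp, assumption, rule that)
  show ?thesis
  proof (rule that[of "1 / m"])
    show "1 / m > 0" using m(1) by simp
    show "dist (f x) (f y) \<le> 1 / m * dist x y" if "x \<in> K" "y \<in> K" for x y
      using m(2)[of "(x, y)"] m(1) that by (simp add: field_simps)
  qed
qed

text \<open>Away from the diagonal this is injectivity of each \<open>F(s, \<cdot>)\<close> and compactness. Near a diagonal
  point \<open>(s, p, p)\<close>, the smooth inverse of \<open>F(s, \<cdot>)\<close> is Lipschitz with some constant \<open>C\<close>, which
  is a lower bound \<open>1 / C\<close> for this one \<open>s\<close>; strict differentiability of \<open>F\<close> in all variables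
  shows that the difference \<open>F(t, x) - F(t, y)\<close> varies with \<open>t\<close> by at most half of that.\<close>

lemma uniform_lower_bound_of_embeddings:
  fixes F :: "real \<times> 'a::euclidean_space \<Rightarrow> 'b::euclidean_space"
  assumes K: "compact K" and F: "smooth_on ({0..1} \<times> K) F"
    and diffeo: "\<And>s. s \<in> {0..1} \<Longrightarrow> diffeomorphism_betw K ((\<lambda>p. F (s, p)) ` K) (\<lambda>p. F (s, p))"
  obtains m where "m > 0"
    "\<And>s p q. s \<in> {0..1} \<Longrightarrow> p \<in> K \<Longrightarrow> q \<in> K \<Longrightarrow> m * dist p q \<le> dist (F (s, p)) (F (s, q))"
proof -
  obtain D where D: "D > 0" "\<And>x y. x \<in> K \<Longrightarrow> y \<in> K \<Longrightarrow> dist x y \<le> D"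
    by (rule compact_diameter_bound[OF K]) (rule that)
  have contF: "continuous_on ({0..1} \<times> K) F" by (rule smooth_on_imp_continuous_on[OF F])
  let ?Q = "{0..1::real} \<times> K \<times> K"
  let ?a = "\<lambda>z::real \<times> 'a \<times> 'a. dist (fst (snd z)) (snd (snd z))"
  let ?b = "\<lambda>z. dist (F (fst z, fst (snd z))) (F (fst z, snd (snd z)))"
  have contb: "continuous_on ?Q ?b"
    by (intro continuous_on_dist continuous_on_compose2[OF contF] continuous_intros) auto
  have local: "\<exists>U m. open U \<and> z \<in> U \<and> m > 0 \<and> (\<forall>y\<in>?Q \<inter> U. m * ?a y \<le> ?b y)"
    if z: "z \<in> ?Q" for z
  proof -
    obtain s p q where zeq: "z = (s, p, q)" by (cases z)
    have s: "s \<in> {0..1}" and p: "p \<in> K" and q: "q \<in> K" using z by (simp_all add: zeq)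
    have bij: "bij_betw (\<lambda>p. F (s, p)) K ((\<lambda>p. F (s, p)) ` K)"
      and inv: "smooth_on ((\<lambda>p. F (s, p)) ` K) (inv_into K (\<lambda>p. F (s, p)))"
      using diffeo[OF s] unfolding diffeomorphism_betw_def by auto
    then have inj: "inj_on (\<lambda>p. F (s, p)) K" by (simp add: bij_betw_def)
    show ?thesis
    proof (cases "p = q")
      case False
      define e where "e = ?b z"
      have e: "e > 0" using inj_onD[OF inj _ p q] False by (auto simp: e_def zeq)
      obtain U where U: "open U" "U \<inter> ?Q = ?b -` {e / 2<..} \<inter> ?Q"
        using contb[unfolded continuous_on_open_invariant, rule_format, OF open_greaterThan] by blast
      have "z \<in> U" using U(2) z e by (auto simp: e_def)
      moreover have "(e / 2 / D) * ?a y \<le> ?b y" if y: "y \<in> ?Q \<inter> U" for y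
      proof -
        have "(e / 2 / D) * ?a y \<le> (e / 2 / D) * D"
          using D y e by (intro mult_left_mono) auto
        also have "\<dots> = e / 2" using D(1) by simp
        also have "\<dots> \<le> ?b y"
        proof -
          have "y \<in> ?b -` {e / 2<..}" using U(2) y by blast
          then show ?thesis by simp
        qed
        finally show ?thesis .
      qed
      ultimately show ?thesis using U(1) e D(1) by (intro exI[of _ U] exI[of _ "e / 2 / D"]) auto
    next
      case True
      obtain U G where U: "open U" "(s, p) \<in> U" "\<And>k. Ck_on k U G"
        "\<And>x. x \<in> {0..1} \<times> K \<Longrightarrow> x \<in> U \<Longrightarrow> G x = F x"
        by (rule smooth_on_extension[OF F, of "(s, p)"]) (use s p in simp, rule that)
      have "F (s, p) \<in> (\<lambda>p. F (s, p)) ` K" using p by blast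
      then obtain V k where V: "open V" "F (s, p) \<in> V" "\<And>n. Ck_on n V k"
        "\<And>y. y \<in> (\<lambda>p. F (s, p)) ` K \<Longrightarrow> y \<in> V \<Longrightarrow> k y = inv_into K (\<lambda>p. F (s, p)) y"
        by (rule smooth_on_extension[OF inv]) (rule that)
      have kF: "k (F (s, x)) = x" if "x \<in> K" "F (s, x) \<in> V" for x
        using V(4)[of "F (s, x)"] that inv_into_f_f[OF inj] by simp
      obtain \<rho> C where \<rho>: "\<rho> > 0" "C > 0" "ball (F (s, p)) \<rho> \<subseteq> V"
        "\<And>x y. x \<in> ball (F (s, p)) \<rho> \<Longrightarrow> y \<in> ball (F (s, p)) \<rho> \<Longrightarrow> dist (k x) (k y) \<le> C * dist x y"
        by (rule Ck_on_locally_lipschitz[OF V(1) V(3) V(2)]) (rule that)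
      \<comment> \<open>Two error terms of size \<open>\<epsilon>\<close> use up half of the lower bound \<open>1 / C\<close>.\<close>
      define \<epsilon> where "\<epsilon> = 1 / (4 * C)"
      have \<epsilon>: "\<epsilon> > 0" using \<rho>(2) by (simp add: \<epsilon>_def)
      let ?DG = "frechet_derivative G (at (s, p))"
      obtain r where r: "r > 0" "ball (s, p) r \<subseteq> U"
        "\<And>x y. x \<in> ball (s, p) r \<Longrightarrow> y \<in> ball (s, p) r \<Longrightarrow>
          norm (G x - G y - ?DG (x - y)) \<le> \<epsilon> * norm (x - y)"
        by (rule strictly_differentiable[OF U(1) U(3) U(2) \<epsilon>]) (rule that)
      have "continuous_on K (\<lambda>x. F (s, x))"
        by (rule continuous_on_compose2[OF contF]) (use s in \<open>auto intro!: continuous_intros\<close>)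
      then have "\<exists>d>0. \<forall>x\<in>K. dist x p < d \<longrightarrow> dist (F (s, x)) (F (s, p)) < \<rho>"
        using p \<rho>(1) unfolding continuous_on_iff by blast
      then obtain d where d: "d > 0" "\<And>x. x \<in> K \<Longrightarrow> dist x p < d \<Longrightarrow> dist (F (s, x)) (F (s, p)) < \<rho>"
        by blast
      define \<delta> where "\<delta> = min d (r / 2)"
      have \<delta>: "\<delta> > 0" "\<delta> \<le> d" "2 * \<delta> \<le> r" using d r by (auto simp: \<delta>_def)
      have est: "1 / (2 * C) * dist x y \<le> dist (F (t, x)) (F (t, y))"
        if t: "t \<in> {0..1}" "dist t s < \<delta>" and x: "x \<in> K" "dist x p < \<delta>" and y: "y \<in> K" "dist y p < \<delta>"
        for t x y
      proof -
        have inb: "(t', x') \<in> ball (s, p) r" if "dist t' s < \<delta>" "dist x' p < \<delta>" for t' x'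
        proof -
          have "dist (s, p) (t', x') \<le> dist s t' + dist p x'"
            unfolding dist_Pair_Pair by (rule sqrt_sum_squares_le_sum) auto
          then show ?thesis using that \<delta>(3) by (simp add: dist_commute)
        qed
        have ss: "dist s s < \<delta>" using \<delta>(1) by simp
        have eqG: "G (t', x') = F (t', x')" if "t' \<in> {0..1}" "x' \<in> K" "dist t' s < \<delta>" "dist x' p < \<delta>" for t' x'
          using U(4)[of "(t', x')"] inb[OF that(3,4)] r(2) that(1,2) by blast
        have "norm (F (t, x) - F (t, y) - ?DG (0, x - y)) \<le> \<epsilon> * dist x y"
          using r(3)[OF inb[OF t(2) x(2)] inb[OF t(2) y(2)]]
            eqG[OF t(1) x(1) t(2) x(2)] eqG[OF t(1) y(1) t(2) y(2)] by (simp add: dist_norm norm_Pair)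
        moreover have "norm (F (s, x) - F (s, y) - ?DG (0, x - y)) \<le> \<epsilon> * dist x y"
          using r(3)[OF inb[OF ss x(2)] inb[OF ss y(2)]]
            eqG[OF s x(1) ss x(2)] eqG[OF s y(1) ss y(2)] by (simp add: dist_norm norm_Pair)
        moreover have "norm b \<le> norm (b - c) + norm (a - c) + norm a" for a b c :: 'b
          by norm
        ultimately have "norm (F (s, x) - F (s, y)) \<le> norm (F (t, x) - F (t, y)) + 2 * (\<epsilon> * dist x y)"
          by (smt (verit))
        moreover have "dist x y \<le> C * dist (F (s, x)) (F (s, y))"
        proof -
          have "F (s, x) \<in> ball (F (s, p)) \<rho>" "F (s, y) \<in> ball (F (s, p)) \<rho>"
            using d(2)[OF x(1)] d(2)[OF y(1)] x(2) y(2) \<delta>(2) by (auto simp: dist_commute)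
          then show ?thesis using \<rho>(4)[of "F (s, x)" "F (s, y)"] kF[OF x(1)] kF[OF y(1)] subsetD[OF \<rho>(3)] by simp
        qed
        ultimately have "dist x y \<le> C * (dist (F (t, x)) (F (t, y)) + 2 * (\<epsilon> * dist x y))"
          using mult_left_mono[OF _ less_imp_le[OF \<rho>(2)]] by (fastforce simp: dist_norm intro: order_trans)
        also have "\<dots> = C * dist (F (t, x)) (F (t, y)) + dist x y / 2"
          using \<rho>(2) by (simp add: \<epsilon>_def algebra_simps)
        finally have "dist x y \<le> 2 * C * dist (F (t, x)) (F (t, y))" by simp
        then show ?thesis using \<rho>(2) by (simp add: field_simps)
      qed
      have "z \<in> ball s \<delta> \<times> ball p \<delta> \<times> ball p \<delta>" using \<delta>(1) True by (simp add: zeq)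
      moreover have "1 / (2 * C) * ?a y \<le> ?b y" if "y \<in> ?Q \<inter> (ball s \<delta> \<times> ball p \<delta> \<times> ball p \<delta>)" for y
        using that est[of "fst y" "fst (snd y)" "snd (snd y)"] by (auto simp: dist_commute)
      ultimately show ?thesis
        using \<rho>(2) by (intro exI[of _ "ball s \<delta> \<times> ball p \<delta> \<times> ball p \<delta>"] exI[of _ "1 / (2 * C)"])
          (auto simp: open_Times)
    qed
  qed
  obtain m where m: "m > 0" "\<And>z. z \<in> ?Q \<Longrightarrow> m * ?a z \<le> ?b z"
    by (rule compact_uniform_factor[OF compact_Times[OF compact_Icc compact_Times[OF K K]] _ local])
      (simp, assumption, rule that)
  show ?thesis
    by (rule that[OF m(1)]) (use m(2)[of "(s, p, q)" for s p q] in auto)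
qed

section \<open>The time derivative of an isotopy\<close>

text \<open>At \<open>s = 0\<close> and \<open>s = 1\<close> only the one-sided derivative of \<open>F\<close> is defined by \<open>F\<close> itself; it
  already determines the time derivative of every extension.\<close>

lemma time_derivative_of_extension:
  fixes F :: "real \<times> 'a::euclidean_space \<Rightarrow> 'b::euclidean_space"
  assumes U: "open U" "Ck_on (Suc 0) U G" "\<And>x. x \<in> {0..1} \<times> K \<Longrightarrow> x \<in> U \<Longrightarrow> G x = F x"
    and z: "(s, p) \<in> {0..1} \<times> K" "(s, p) \<in> U"
  shows "vector_derivative (\<lambda>r. F (r, p)) (at s within {0..1}) = frechet_derivative G (at (s, p)) (1, 0)"
proof (rule vector_derivative_within_closed_interval)
  obtain e where e: "e > 0" "ball (s, p) e \<subseteq> U" using U(1) z(2) openE by blast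
  have D: "(G has_derivative frechet_derivative G (at (s, p))) (at (s, p))"
    by (rule Ck_on_has_derivative[OF U(2) z(2)])
  have "((\<lambda>r. (r, p)) has_derivative (\<lambda>r. (r, 0))) (at s within {0..1})"
    by (rule has_derivative_Pair[OF has_derivative_ident has_derivative_const])
  from has_derivative_compose[OF this D]
  have "((\<lambda>r. G (r, p)) has_derivative (\<lambda>r. frechet_derivative G (at (s, p)) (r, 0))) (at s within {0..1})" .
  moreover have "(\<lambda>r. frechet_derivative G (at (s, p)) (r, 0)) =
      (\<lambda>r. r *\<^sub>R frechet_derivative G (at (s, p)) (1, 0))"
  proof
    fix r :: real
    show "frechet_derivative G (at (s, p)) (r, 0) = r *\<^sub>R frechet_derivative G (at (s, p)) (1, 0)"
      using linear_scale[OF has_derivative_linear[OF D], of r "(1, 0)"] by simp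
  qed
  ultimately have "((\<lambda>r. G (r, p)) has_vector_derivative frechet_derivative G (at (s, p)) (1, 0)) (at s within {0..1})"
    by (simp only: has_vector_derivative_def)
  then show "((\<lambda>r. F (r, p)) has_vector_derivative frechet_derivative G (at (s, p)) (1, 0)) (at s within {0..1})"
  proof (rule has_vector_derivative_transform_within[OF _ e(1)])
    fix r assume r: "r \<in> {0..1}" "dist r s < e"
    have "(r, p) \<in> ball (s, p) e" using r(2) by (simp add: dist_Pair_Pair dist_commute)
    then show "G (r, p) = F (r, p)" using subsetD[OF e(2)] r(1) z(1) by (intro U(3)) auto
  qed (use z in auto)
qed (use z in auto)

lemma smooth_on_time_derivative:
  fixes F :: "real \<times> 'a::euclidean_space \<Rightarrow> 'b::euclidean_space"
  assumes F: "smooth_on ({0..1} \<times> K) F"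
  shows "smooth_on ({0..1} \<times> K) (\<lambda>(s, p). vector_derivative (\<lambda>r. F (r, p)) (at s within {0..1}))"
proof (rule smooth_onI)
  fix z :: "real \<times> 'a" assume z: "z \<in> {0..1} \<times> K"
  obtain U G where U: "open U" "z \<in> U" "\<And>k. Ck_on k U G" "\<And>x. x \<in> {0..1} \<times> K \<Longrightarrow> x \<in> U \<Longrightarrow> G x = F x"
    by (rule smooth_on_extension[OF F z]) (rule that)
  have "Ck_on k U (\<lambda>x. frechet_derivative G (at x) (1, 0))" for k
    using U(3)[of "Suc k"] by simp
  moreover have "frechet_derivative G (at x) (1, 0)
      = (case x of (s, p) \<Rightarrow> vector_derivative (\<lambda>r. F (r, p)) (at s within {0..1}))"
    if "x \<in> {0..1} \<times> K \<inter> U" for x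
  proof (cases x)
    case (Pair s p)
    show ?thesis
      unfolding Pair prod.case
      by (rule time_derivative_of_extension[OF U(1) U(3) U(4), symmetric]) (use that Pair in auto)
  qed
  ultimately show "\<exists>U g. open U \<and> z \<in> U \<and> (\<forall>k. Ck_on k U g) \<and> (\<forall>x\<in>{0..1} \<times> K \<inter> U. g x =
      (case x of (s, p) \<Rightarrow> vector_derivative (\<lambda>r. F (r, p)) (at s within {0..1})))"
    using U(1,2) by (intro exI[of _ U] exI[of _ "\<lambda>x. frechet_derivative G (at x) (1, 0)"]) auto
qed

section \<open>The trace of a slowed-down isotopy\<close>

text \<open>The trace of the isotopy, displaced by the speed \<open>s'\<close> times a field \<open>N\<close>, is bounded below
  once the isotopy is run slowly. Within a time slice, \<open>F(s, \<cdot>)\<close> multiplies distances by at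
  least \<open>m\<close>, and the displacement takes away at most \<open>m / 2\<close> if the speed is at most
  \<open>m / (2 C\<^sub>N)\<close>, with \<open>C\<^sub>N\<close> the Lipschitz constant of \<open>N\<close>. Between slices the time
  coordinate itself provides the bound.\<close>

lemma smooth_trace_lower_bound:
  fixes F N :: "real \<times> 'a::euclidean_space \<Rightarrow> 'b::euclidean_space"
  assumes K: "compact K" and F: "smooth_on ({0..1} \<times> K) F" and N: "smooth_on ({0..1} \<times> K) N"
    and diffeo: "\<And>s. s \<in> {0..1} \<Longrightarrow> diffeomorphism_betw K ((\<lambda>p. F (s, p)) ` K) (\<lambda>p. F (s, p))"
  obtains T s s' c where "T > 0" "\<And>k. Ck_on k UNIV s" "\<And>k. Ck_on k UNIV s'"
    "\<And>t. (s has_real_derivative s' t) (at t)" "\<And>t. s t \<in> {0..1}"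
    "\<And>t. t \<le> - T \<Longrightarrow> s t = 0 \<and> s' t = 0" "\<And>t. t \<ge> T \<Longrightarrow> s t = 1 \<and> s' t = 0" "c > 0"
    "\<And>t u p q. p \<in> K \<Longrightarrow> q \<in> K \<Longrightarrow> c * dist (t, p) (u, q) \<le>
      dist (t, F (s t, p) + s' t *\<^sub>R N (s t, p)) (u, F (s u, q) + s' u *\<^sub>R N (s u, q))"
proof -
  have K1: "compact ({0..1::real} \<times> K)" by (rule compact_Times[OF compact_Icc K])
  obtain m where m: "m > 0"
    "\<And>s p q. s \<in> {0..1} \<Longrightarrow> p \<in> K \<Longrightarrow> q \<in> K \<Longrightarrow> m * dist p q \<le> dist (F (s, p)) (F (s, q))"
    by (rule uniform_lower_bound_of_embeddings[OF K F diffeo]) (assumption, rule that)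
  obtain CF where CF: "CF > 0" "\<And>x y. x \<in> {0..1} \<times> K \<Longrightarrow> y \<in> {0..1} \<times> K \<Longrightarrow> dist (F x) (F y) \<le> CF * dist x y"
    by (rule smooth_on_compact_lipschitz[OF K1 F]) (rule that)
  obtain CN where CN: "CN > 0" "\<And>x y. x \<in> {0..1} \<times> K \<Longrightarrow> y \<in> {0..1} \<times> K \<Longrightarrow> dist (N x) (N y) \<le> CN * dist x y"
    by (rule smooth_on_compact_lipschitz[OF K1 N]) (rule that)
  have "bounded (N ` ({0..1} \<times> K))"
    by (rule compact_imp_bounded[OF compact_continuous_image[OF smooth_on_imp_continuous_on[OF N] K1]])
  then obtain M where M: "M > 0" "\<And>x. x \<in> {0..1} \<times> K \<Longrightarrow> norm (N x) \<le> M"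
    unfolding bounded_pos by blast
  \<comment> \<open>the largest speed at which the displacement costs at most half of the factor \<open>m\<close>\<close>
  define \<epsilon> where "\<epsilon> = m / (2 * CN)"
  have \<epsilon>: "\<epsilon> > 0" "\<epsilon> * CN = m / 2" using m(1) CN(1) by (simp_all add: \<epsilon>_def)
  obtain T s s' B where s: "T > 0" "\<And>k. Ck_on k UNIV s" "\<And>k. Ck_on k UNIV s'"
    "\<And>t. (s has_real_derivative s' t) (at t)" "\<And>t. s t \<in> {0..1}" and s'\<epsilon>: "\<And>t. \<bar>s' t\<bar> \<le> \<epsilon>"
    and s_end: "\<And>t. t \<le> - T \<Longrightarrow> s t = 0 \<and> s' t = 0" "\<And>t. t \<ge> T \<Longrightarrow> s t = 1 \<and> s' t = 0"
    and B: "B > 0" "\<And>t u. \<bar>s t - s u\<bar> \<le> B * \<bar>t - u\<bar>" "\<And>t u. \<bar>s' t - s' u\<bar> \<le> B * \<bar>t - u\<bar>"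
    by (rule slow_smooth_step[OF \<epsilon>(1)]) (rule that)
  let ?G = "\<lambda>t p. F (s t, p) + s' t *\<^sub>R N (s t, p)"
  have in_dom: "(s t, p) \<in> {0..1} \<times> K" if "p \<in> K" for t p using s(5) that by simp
  have slice: "m / 2 * dist p q \<le> dist (?G t p) (?G t q)" if pq: "p \<in> K" "q \<in> K" for t p q
  proof -
    have "norm (s' t *\<^sub>R N (s t, p) - s' t *\<^sub>R N (s t, q)) = \<bar>s' t\<bar> * dist (N (s t, p)) (N (s t, q))"
      by (simp add: dist_norm flip: scaleR_diff_right)
    also have "\<dots> \<le> \<epsilon> * (CN * dist p q)"
      by (rule mult_mono[OF s'\<epsilon>]) (use CN(2)[OF in_dom[OF pq(1)] in_dom[OF pq(2)], of t t] \<epsilon>(1) in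
          \<open>simp_all add: dist_Pair_Pair\<close>)
    also have "\<dots> = m / 2 * dist p q" using \<epsilon>(2) by (simp flip: mult.assoc)
    finally have 1: "norm (s' t *\<^sub>R N (s t, p) - s' t *\<^sub>R N (s t, q)) \<le> m / 2 * dist p q" .
    have "m * dist p q \<le> norm (F (s t, p) - F (s t, q))"
      using m(2)[OF s(5) pq] by (simp add: dist_norm)
    also have "\<dots> = norm ((?G t p - ?G t q) - (s' t *\<^sub>R N (s t, p) - s' t *\<^sub>R N (s t, q)))"
      by (simp add: algebra_simps)
    also have "\<dots> \<le> norm (?G t p - ?G t q) + m / 2 * dist p q"
      by (rule order_trans[OF norm_triangle_ineq4 add_left_mono[OF 1]])
    finally show ?thesis by (simp add: dist_norm)
  qed
  define C where "C = CF * B + \<epsilon> * (CN * B) + B * M"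
  have C: "C > 0" unfolding C_def using CF(1) B(1) \<epsilon>(1) CN(1) M(1) by (simp add: add_pos_pos)
  have time: "dist (?G t q) (?G u q) \<le> C * \<bar>t - u\<bar>" if q: "q \<in> K" for t u q
  proof -
    have st: "dist (s t, q) (s u, q) \<le> B * \<bar>t - u\<bar>"
      using B(2)[of t u] by (simp add: dist_Pair_Pair dist_real_def)
    have "dist (F (s t, q)) (F (s u, q)) \<le> CF * dist (s t, q) (s u, q)"
      by (rule CF(2)[OF in_dom[OF q] in_dom[OF q]])
    also have "\<dots> \<le> CF * (B * \<bar>t - u\<bar>)" using st CF(1) by (intro mult_left_mono) auto
    finally have 1: "norm (F (s t, q) - F (s u, q)) \<le> CF * (B * \<bar>t - u\<bar>)" by (simp add: dist_norm)
    have "dist (N (s t, q)) (N (s u, q)) \<le> CN * dist (s t, q) (s u, q)"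
      by (rule CN(2)[OF in_dom[OF q] in_dom[OF q]])
    also have "\<dots> \<le> CN * (B * \<bar>t - u\<bar>)" using st CN(1) by (intro mult_left_mono) auto
    finally have "\<bar>s' t\<bar> * norm (N (s t, q) - N (s u, q)) \<le> \<epsilon> * (CN * (B * \<bar>t - u\<bar>))"
      by (intro mult_mono[OF s'\<epsilon>]) (use \<epsilon>(1) in \<open>simp_all add: dist_norm\<close>)
    then have 2: "norm (s' t *\<^sub>R (N (s t, q) - N (s u, q))) \<le> \<epsilon> * (CN * (B * \<bar>t - u\<bar>))" by simp
    have "\<bar>s' t - s' u\<bar> * norm (N (s u, q)) \<le> (B * \<bar>t - u\<bar>) * M"
      by (rule mult_mono[OF B(3) M(2)[OF in_dom[OF q]]]) (use B(1) in auto)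
    then have 3: "norm ((s' t - s' u) *\<^sub>R N (s u, q)) \<le> (B * \<bar>t - u\<bar>) * M" by simp
    have "?G t q - ?G u q = (F (s t, q) - F (s u, q)) + s' t *\<^sub>R (N (s t, q) - N (s u, q))
        + (s' t - s' u) *\<^sub>R N (s u, q)"
      by (simp add: algebra_simps)
    moreover have "norm (a + b + c) \<le> norm a + norm b + norm c" for a b c :: 'b by norm
    ultimately have "dist (?G t q) (?G u q) \<le> norm (F (s t, q) - F (s u, q))
        + norm (s' t *\<^sub>R (N (s t, q) - N (s u, q))) + norm ((s' t - s' u) *\<^sub>R N (s u, q))"
      by (simp only: dist_norm)
    also have "\<dots> \<le> C * \<bar>t - u\<bar>" using 1 2 3 by (simp add: C_def algebra_simps)
    finally show ?thesis .
  qed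
  \<comment> \<open>With \<open>d\<close> the distance of the images, \<open>dist t u \<le> d\<close> and \<open>m / 2 * dist p q \<le> (1 + C) * d\<close>.\<close>
  define E where "E = 1 + 2 * (1 + C) / m"
  have E: "E > 0" unfolding E_def using C m(1) by (simp add: add_pos_nonneg)
  have lower: "1 / E * dist (t, p) (u, q) \<le> dist (t, ?G t p) (u, ?G u q)" if pq: "p \<in> K" "q \<in> K" for t u p q
  proof -
    let ?d = "dist (t, ?G t p) (u, ?G u q)"
    have d1: "\<bar>t - u\<bar> \<le> ?d" and d2: "dist (?G t p) (?G u q) \<le> ?d"
      using dist_fst_le[of "(t, ?G t p)" "(u, ?G u q)"] dist_snd_le[of "(t, ?G t p)" "(u, ?G u q)"]
      by (simp_all add: dist_real_def)
    have "m / 2 * dist p q \<le> dist (?G t p) (?G t q)" by (rule slice[OF pq])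
    also have "\<dots> \<le> dist (?G t p) (?G u q) + dist (?G t q) (?G u q)" by (rule dist_triangle2)
    also have "\<dots> \<le> ?d + C * ?d"
      using d2 time[OF pq(2), of t u] mult_left_mono[OF d1, of C] C by linarith
    finally have "dist p q \<le> 2 * (1 + C) / m * ?d" using m(1) by (simp add: field_simps)
    moreover have "dist (t, p) (u, q) \<le> \<bar>t - u\<bar> + dist p q"
      unfolding dist_Pair_Pair dist_real_def by (rule sqrt_sum_squares_le_sum) auto
    ultimately have "dist (t, p) (u, q) \<le> E * ?d" using d1 by (simp add: E_def algebra_simps)
    then show ?thesis using E by (simp add: field_simps)
  qed
  have E': "1 / E > 0" using E by simp
  show ?thesis by (rule that[OF s s_end E' lower])
qed

text \<open>The contact form does not see the base coordinate \<open>z\<close>, so shifting a point in that direction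
  only adds the derivative of the shift.\<close>

lemma liouville_form_vertical_shift:
  "liouville_form (t, q + (0, 0, a)) (\<tau>, v + (0, 0, b)) = exp t * (contact_form q v + b)"
  by (simp add: liouville_form_eq contact_form_eq)

text \<open>The identity behind the theorem. Along a curve \<open>\<beta> = (t, p)\<close> in the cylinder, the velocity of
  \<open>F(s(t), p)\<close> is \<open>s' t'\<close> times the time derivative of \<open>F\<close> plus a vector tangent to the
  Legendrian slice. The contact form takes the value \<open>t' g\<close> on it, since it vanishes on the second
  part and \<open>g = s' H\<close>. The vertical shift by \<open>g\<close> contributes \<open>g'\<close>, and
  \<open>e\<^sup>t (t' g + g') = (e\<^sup>t g)'\<close>.\<close>

lemma liouville_form_on_trace:
  fixes F :: "real \<times> 'n::finite contact_space \<Rightarrow> 'n contact_space" and K s s'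
  defines "F' \<equiv> \<lambda>(s, p). vector_derivative (\<lambda>r. F (r, p)) (at s within {0..1})"
  defines "H \<equiv> \<lambda>z. contact_form (F z) (F' z)"
  defines "g \<equiv> \<lambda>z. s' (fst z) * H (s (fst z), snd z)"
  defines "\<Phi> \<equiv> \<lambda>z. (fst z, F (s (fst z), snd z) + (0, 0, g z))"
  assumes F: "smooth_on ({0..1} \<times> K) F"
    and leg: "\<And>s. s \<in> {0..1} \<Longrightarrow> legendrian ((\<lambda>p. F (s, p)) ` K)"
    and s: "\<And>k. Ck_on k UNIV s" "\<And>t. (s has_real_derivative s' t) (at t)" "\<And>t. s t \<in> {0..1}"
    and g: "smooth_on (UNIV \<times> K) g"
    and \<beta>: "curve_through (UNIV \<times> K) z w \<beta>"
  obtains v l where "((\<lambda>r. \<Phi> (\<beta> r)) has_vector_derivative v) (at 0)"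
    "((\<lambda>r. exp (fst (\<beta> r)) * g (\<beta> r)) has_vector_derivative l) (at 0)"
    "liouville_form (\<Phi> z) v = l"
proof -
  obtain t p where z: "z = (t, p)" by (cases z)
  obtain \<tau> \<omega> where w: "w = (\<tau>, \<omega>)" by (cases w)
  have p: "p \<in> K" using curve_through_base[OF \<beta>] by (simp add: z)
  have \<beta>0: "\<beta> 0 = (t, p)" and d\<beta>: "(\<beta> has_vector_derivative (\<tau>, \<omega>)) (at 0)"
    by (rule curve_throughE[OF \<beta>], simp add: z w)+
  have d1: "((\<lambda>r. fst (\<beta> r)) has_vector_derivative \<tau>) (at 0)"
    and d2: "((\<lambda>r. snd (\<beta> r)) has_vector_derivative \<omega>) (at 0)"
    using bounded_linear.has_vector_derivative[OF bounded_linear_fst d\<beta>]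
      bounded_linear.has_vector_derivative[OF bounded_linear_snd d\<beta>] by simp_all
  have sp: "(s t, p) \<in> {0..1} \<times> K" using s(3) p by simp
  obtain U G where U: "open U" "(s t, p) \<in> U" "\<And>k. Ck_on k U G"
      "\<And>x. x \<in> {0..1} \<times> K \<Longrightarrow> x \<in> U \<Longrightarrow> G x = F x"
    by (rule smooth_on_extension[OF F sp]) (rule that)
  let ?DG = "frechet_derivative G (at (s t, p))"
  have DG: "(G has_derivative ?DG) (at (s t, p))" by (rule Ck_on_has_derivative[OF U(3,2)])
  have lin: "linear ?DG" by (rule has_derivative_linear[OF DG])
  have F': "F' (s t, p) = ?DG (1, 0)"
    unfolding F'_def prod.case by (rule time_derivative_of_extension[OF U(1,3,4) sp U(2)])
  have cur2: "curve_through K p \<omega> (\<lambda>r. snd (\<beta> r))"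
  proof -
    have "curve_through K (snd z) \<omega> (\<lambda>r. snd (\<beta> r))"
      by (rule curve_through_image[OF smooth_on_bounded_linear[OF bounded_linear_snd] _ \<beta> d2]) auto
    then show ?thesis by (simp add: z)
  qed
  have s_smooth: "smooth_on UNIV s" by (rule smooth_on_Ck[OF open_UNIV s(1)]) simp
  let ?\<kappa> = "\<lambda>z::real \<times> 'n contact_space. (s (fst z), snd z)"
  have \<kappa>: "smooth_on (UNIV \<times> K) ?\<kappa>" "?\<kappa> ` (UNIV \<times> K) \<subseteq> {0..1} \<times> K"
  proof -
    show "smooth_on (UNIV \<times> K) ?\<kappa>"
      by (rule smooth_on_Pair[OF smooth_on_compose[OF smooth_on_bounded_linear[OF bounded_linear_fst] s_smooth]
            smooth_on_bounded_linear[OF bounded_linear_snd]]) simp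
    show "?\<kappa> ` (UNIV \<times> K) \<subseteq> {0..1} \<times> K" using s(3) by auto
  qed
  have "((\<lambda>r. s (fst (\<beta> r))) has_vector_derivative s' t * \<tau>) (at 0)"
  proof -
    have "((\<lambda>r. fst (\<beta> r)) has_real_derivative \<tau>) (at 0)"
      using d1 by (simp add: has_real_derivative_iff_has_vector_derivative)
    from DERIV_chain2[OF s(2) this] show ?thesis
      by (simp add: has_real_derivative_iff_has_vector_derivative \<beta>0)
  qed
  then have "((\<lambda>r. ?\<kappa> (\<beta> r)) has_vector_derivative (s' t * \<tau>, \<omega>)) (at 0)"
    using d2 by (rule has_vector_derivative_Pair)
  then have cur\<kappa>: "curve_through ({0..1} \<times> K) (s t, p) (s' t * \<tau>, \<omega>) (\<lambda>r. ?\<kappa> (\<beta> r))"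
    using curve_through_image[OF \<kappa> \<beta>] by (simp add: z)
  have split: "?DG (s' t * \<tau>, \<omega>) = (s' t * \<tau>) *\<^sub>R F' (s t, p) + ?DG (0, \<omega>)"
    using linear_add[OF lin, of "(s' t * \<tau>, 0)" "(0, \<omega>)"] linear_scale[OF lin, of "s' t * \<tau>" "(1, 0)"]
    by (simp add: F')
  have dF: "((\<lambda>r. F (?\<kappa> (\<beta> r))) has_vector_derivative (s' t * \<tau>) *\<^sub>R F' (s t, p) + ?DG (0, \<omega>)) (at 0)"
    unfolding split[symmetric] by (rule curve_through_chain[OF cur\<kappa> DG U(1,2,4)])
  have horizontal: "contact_form (F (s t, p)) (?DG (0, \<omega>)) = 0"
  proof -
    let ?i = "\<lambda>p::'n contact_space. (s t, p)"
    have i: "smooth_on K ?i" "?i ` K \<subseteq> {0..1} \<times> K"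
      using s(3) smooth_on_Pair[OF smooth_on_const smooth_on_bounded_linear[OF bounded_linear_ident]]
      by auto
    have "((\<lambda>r. ?i (snd (\<beta> r))) has_vector_derivative (0, \<omega>)) (at 0)"
      by (rule has_vector_derivative_Pair[OF has_vector_derivative_const d2])
    from curve_through_image[OF i cur2 this]
    have dFi: "((\<lambda>r. F (?i (snd (\<beta> r)))) has_vector_derivative ?DG (0, \<omega>)) (at 0)"
      by (rule curve_through_chain[OF _ DG U(1,2,4)])
    have Fi: "smooth_on K (\<lambda>p. F (s t, p))" by (rule smooth_on_compose[OF i(1) F i(2)])
    have "curve_through ((\<lambda>p. F (s t, p)) ` K) (F (s t, p)) (?DG (0, \<omega>)) (\<lambda>r. F (?i (snd (\<beta> r))))"
      by (rule curve_through_image[OF Fi _ cur2 dFi]) simp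
    then have "?DG (0, \<omega>) \<in> tangent_space ((\<lambda>p. F (s t, p)) ` K) (F (s t, p))"
      unfolding tangent_space_def by blast
    moreover have "F (s t, p) \<in> (\<lambda>p. F (s t, p)) ` K" using p by blast
    ultimately show ?thesis
      using leg[OF s(3)] unfolding legendrian_def contact_structure_def by blast
  qed
  obtain V f where V: "open V" "z \<in> V" "\<And>k. Ck_on k V f" "\<And>x. x \<in> UNIV \<times> K \<Longrightarrow> x \<in> V \<Longrightarrow> f x = g x"
    by (rule smooth_on_extension[OF g curve_through_base[OF \<beta>]]) (rule that)
  obtain l where dg: "((\<lambda>r. g (\<beta> r)) has_vector_derivative l) (at 0)"
    by (rule that[OF curve_through_chain[OF \<beta> Ck_on_has_derivative[OF V(3,2)] V(1,2,4)]])
  let ?v = "(\<tau>, ((s' t * \<tau>) *\<^sub>R F' (s t, p) + ?DG (0, \<omega>)) + (0, 0, l))"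
  show ?thesis
  proof (rule that[of ?v "exp t * (\<tau> * g z + l)"])
    show "((\<lambda>r. \<Phi> (\<beta> r)) has_vector_derivative ?v) (at 0)"
      unfolding \<Phi>_def
      by (rule has_vector_derivative_Pair[OF d1 has_vector_derivative_add[OF dF
              has_vector_derivative_Pair[OF has_vector_derivative_const
                has_vector_derivative_Pair[OF has_vector_derivative_const dg]]]])
    have "((\<lambda>r. fst (\<beta> r)) has_real_derivative \<tau>) (at 0)" "((\<lambda>r. g (\<beta> r)) has_real_derivative l) (at 0)"
      using d1 dg by (simp_all add: has_real_derivative_iff_has_vector_derivative)
    from DERIV_mult[OF DERIV_chain2[OF DERIV_exp this(1)] this(2)]
    show "((\<lambda>r. exp (fst (\<beta> r)) * g (\<beta> r)) has_vector_derivative exp t * (\<tau> * g z + l)) (at 0)"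
      by (simp add: has_real_derivative_iff_has_vector_derivative \<beta>0 z algebra_simps)
    have "contact_form (F (s t, p)) ((s' t * \<tau>) *\<^sub>R F' (s t, p) + ?DG (0, \<omega>))
        = (s' t * \<tau>) * H (s t, p) + contact_form (F (s t, p)) (?DG (0, \<omega>))"
      by (simp add: contact_form_eq H_def inner_add_right algebra_simps)
    also have "\<dots> = \<tau> * g z" unfolding horizontal by (simp add: g_def z)
    finally have eq: "contact_form (F (s t, p)) ((s' t * \<tau>) *\<^sub>R F' (s t, p) + ?DG (0, \<omega>)) = \<tau> * g z" .
    have \<Phi>z: "\<Phi> z = (t, F (s t, p) + (0, 0, g z))"
      unfolding \<Phi>_def z fst_conv snd_conv by (rule refl)
    show "liouville_form (\<Phi> z) ?v = exp t * (\<tau> * g z + l)"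
      unfolding \<Phi>z liouville_form_vertical_shift eq by (rule refl)
  qed
qed

section \<open>Existence of the cobordism\<close>

theorem proposition1p4:
  fixes \<Lambda>\<^sub>m \<Lambda>\<^sub>p :: "'n::finite contact_space set"
  assumes "legendrian \<Lambda>\<^sub>m" and "compact \<Lambda>\<^sub>m" and "connected \<Lambda>\<^sub>m"
    and "orientable TYPE(real^'n) \<Lambda>\<^sub>m" and "chord_generic \<Lambda>\<^sub>m"
    and "legendrian \<Lambda>\<^sub>p" and "compact \<Lambda>\<^sub>p" and "connected \<Lambda>\<^sub>p"
    and "orientable TYPE(real^'n) \<Lambda>\<^sub>p" and "chord_generic \<Lambda>\<^sub>p"
    and "legendrian_isotopic \<Lambda>\<^sub>m \<Lambda>\<^sub>p"
  shows "\<exists>L. \<Lambda>\<^sub>m \<prec>\<^sup>e\<^sup>x\<^bsub>L\<^esub> \<Lambda>\<^sub>p"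
proof -
  have sub: "smooth_submanifold TYPE(real^'n) \<Lambda>\<^sub>m" using assms(1) unfolding legendrian_def by blast
  obtain F :: "real \<times> 'n contact_space \<Rightarrow> 'n contact_space"
    where F: "smooth_on ({0..1} \<times> \<Lambda>\<^sub>m) F"
    and iso: "\<forall>s\<in>{0..1}. let \<Lambda>\<^sub>s = (\<lambda>p. F (s, p)) ` \<Lambda>\<^sub>m
           in legendrian \<Lambda>\<^sub>s \<and> diffeomorphism_betw \<Lambda>\<^sub>m \<Lambda>\<^sub>s (\<lambda>p. F (s, p))"
    and F0: "\<forall>p\<in>\<Lambda>\<^sub>m. F (0, p) = p" and F1: "(\<lambda>p. F (1, p)) ` \<Lambda>\<^sub>m = \<Lambda>\<^sub>p"
    using assms(11) unfolding legendrian_isotopic_def by (elim exE conjE) (rule that)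
  have leg: "legendrian ((\<lambda>p. F (s, p)) ` \<Lambda>\<^sub>m)"
    and diffeo: "diffeomorphism_betw \<Lambda>\<^sub>m ((\<lambda>p. F (s, p)) ` \<Lambda>\<^sub>m) (\<lambda>p. F (s, p))" if "s \<in> {0..1}" for s
    using iso[rule_format, OF that] by (simp_all add: Let_def)
  define F' where "F' = (\<lambda>(s, p). vector_derivative (\<lambda>r. F (r, p)) (at s within {0..1}))"
  define H where "H z = contact_form (F z) (F' z)" for z
  define N where "N z = (0::real^'n, 0::real^'n, H z)" for z
  let ?I = "{0..1::real} \<times> \<Lambda>\<^sub>m"
  have F': "smooth_on ?I F'" unfolding F'_def by (rule smooth_on_time_derivative[OF F])
  have H: "smooth_on ?I H"
  proof -
    have bl: "bounded_linear (\<lambda>v::'n contact_space. snd (snd v))"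
      "bounded_linear (\<lambda>q::'n contact_space. - fst (snd q))" "bounded_linear (\<lambda>v::'n contact_space. fst v)"
      by (auto intro!: bounded_linear_minus bounded_linear_compose[OF bounded_linear_fst]
          bounded_linear_compose[OF bounded_linear_snd] bounded_linear_fst bounded_linear_snd)
    have "smooth_on ?I (\<lambda>z. snd (snd (F' z)) + (- fst (snd (F z))) \<bullet> fst (F' z))"
      by (rule smooth_on_add[OF smooth_on_linear_compose[OF bl(1) F']
            smooth_on_bilinear[OF bounded_bilinear_inner smooth_on_linear_compose[OF bl(2) F]
              smooth_on_linear_compose[OF bl(3) F']]])
    then show ?thesis by (rule smooth_on_cong) (simp add: H_def contact_form_eq)
  qed
  have N: "smooth_on ?I N"
    unfolding N_def by (rule smooth_on_Pair[OF smooth_on_const smooth_on_Pair[OF smooth_on_const H]])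
  obtain T s s' c where T: "T > 0" and s: "\<And>k. Ck_on k UNIV s" "\<And>k. Ck_on k UNIV s'"
    "\<And>t. (s has_real_derivative s' t) (at t)" "\<And>t. s t \<in> {0..1}"
    and s_end: "\<And>t. t \<le> - T \<Longrightarrow> s t = 0 \<and> s' t = 0" "\<And>t. t \<ge> T \<Longrightarrow> s t = 1 \<and> s' t = 0" and c: "c > 0"
    and low: "\<And>t u p q. p \<in> \<Lambda>\<^sub>m \<Longrightarrow> q \<in> \<Lambda>\<^sub>m \<Longrightarrow> c * dist (t, p) (u, q) \<le>
      dist (t, F (s t, p) + s' t *\<^sub>R N (s t, p)) (u, F (s u, q) + s' u *\<^sub>R N (s u, q))"
    by (rule smooth_trace_lower_bound[OF assms(2) F N diffeo]) (assumption, rule that)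
  define g where "g z = s' (fst z) * H (s (fst z), snd z)" for z
  define \<Phi> where "\<Phi> z = (fst z, F (s (fst z), snd z) + (0, 0, g z))" for z
  let ?C = "(UNIV :: real set) \<times> \<Lambda>\<^sub>m"
  define L where "L = \<Phi> ` ?C"
  have s_smooth: "smooth_on UNIV s" "smooth_on UNIV s'"
    by (rule smooth_on_Ck[OF open_UNIV]; simp add: s)+
  have fst_smooth: "smooth_on ?C fst" by (rule smooth_on_bounded_linear[OF bounded_linear_fst])
  have \<kappa>: "smooth_on ?C (\<lambda>z. (s (fst z), snd z))" "(\<lambda>z. (s (fst z), snd z)) ` ?C \<subseteq> ?I"
  proof -
    show "smooth_on ?C (\<lambda>z. (s (fst z), snd z))"
      by (rule smooth_on_Pair[OF smooth_on_compose[OF fst_smooth s_smooth(1)]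
            smooth_on_bounded_linear[OF bounded_linear_snd]]) simp
    show "(\<lambda>z. (s (fst z), snd z)) ` ?C \<subseteq> ?I" using s(4) by auto
  qed
  have g: "smooth_on ?C g"
    unfolding g_def
    by (rule smooth_on_bilinear[OF bounded_bilinear_mult smooth_on_compose[OF fst_smooth s_smooth(2)]
          smooth_on_compose[OF \<kappa>(1) H \<kappa>(2)]]) simp
  have \<Phi>: "smooth_on ?C \<Phi>"
    unfolding \<Phi>_def
    by (rule smooth_on_Pair[OF fst_smooth smooth_on_add[OF smooth_on_compose[OF \<kappa>(1) F \<kappa>(2)]
            smooth_on_Pair[OF smooth_on_const smooth_on_Pair[OF smooth_on_const g]]]])
  \<comment> \<open>With \<open>N = (0, 0, H)\<close> the displaced trace is \<open>\<Phi>\<close>.\<close>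
  have low\<Phi>: "c * dist x y \<le> dist (\<Phi> x) (\<Phi> y)" if "x \<in> ?C" "y \<in> ?C" for x y
    using low[of "snd x" "snd y" "fst x" "fst y"] that by (auto simp: \<Phi>_def g_def N_def)
  have D: "diffeomorphism_betw ?C L \<Phi>"
    unfolding L_def by (rule diffeomorphism_of_lower_bound[OF submanifold_cylinder[OF sub] \<Phi> c low\<Phi>])
  have Lsub: "smooth_submanifold TYPE(real \<times> (real^'n)) L"
    by (rule submanifold_diffeomorphic_image[OF submanifold_cylinder[OF sub] D])
  have cob: "embedded_cobordism L \<Lambda>\<^sub>m \<Lambda>\<^sub>p"
  proof -
    have neg: "\<Phi> (t, p) = (t, p)" if "t \<le> - T" "p \<in> \<Lambda>\<^sub>m" for t p
      using s_end(1)[OF that(1)] F0 that(2) by (simp add: \<Phi>_def g_def zero_prod_def[symmetric])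
    have pos: "\<Phi> (t, p) = (t, F (1, p))" if "t \<ge> T" for t p
      using s_end(2)[OF that] by (simp add: \<Phi>_def g_def zero_prod_def[symmetric])
    have slab: "L \<inter> (J \<times> UNIV) = \<Phi> ` (J \<times> \<Lambda>\<^sub>m)" for J :: "real set"
      unfolding L_def \<Phi>_def by auto
    have "\<Phi> ` ({..-T} \<times> \<Lambda>\<^sub>m) = id ` ({..-T} \<times> \<Lambda>\<^sub>m)"
      by (rule image_cong) (auto simp: neg)
    then have "L \<inter> ({..-T} \<times> UNIV) = {..-T} \<times> \<Lambda>\<^sub>m" unfolding slab by simp
    moreover have "L \<inter> ({T..} \<times> UNIV) = {T..} \<times> \<Lambda>\<^sub>p"
    proof -
      have "\<Phi> ` ({T..} \<times> \<Lambda>\<^sub>m) = map_prod id (\<lambda>p. F (1, p)) ` ({T..} \<times> \<Lambda>\<^sub>m)"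
        by (rule image_cong) (auto simp: pos)
      then show ?thesis unfolding slab by (simp add: map_prod_image F1)
    qed
    moreover have "compact (L \<inter> ({-T-1..T+1} \<times> UNIV))"
      unfolding slab
      by (intro compact_continuous_image[OF smooth_on_imp_continuous_on[OF smooth_on_subset[OF \<Phi>]]]
          compact_Times compact_Icc assms(2)) auto
    ultimately show ?thesis unfolding embedded_cobordism_def using Lsub T by blast
  qed
  let ?\<Theta> = "inv_into ?C \<Phi>"
  have \<Theta>: "smooth_on L ?\<Theta>" using D unfolding diffeomorphism_betw_def by blast
  have \<Theta>C: "?\<Theta> ` L \<subseteq> ?C" unfolding L_def by (intro image_subsetI inv_into_into)
  have \<Phi>\<Theta>: "\<Phi> (?\<Theta> q) = q" if "q \<in> L" for q using that unfolding L_def by (rule f_inv_into_f)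
  \<comment> \<open>the primitive \<open>e\<^sup>t g\<close>, transported from the cylinder to \<open>L\<close>\<close>
  let ?pot = "\<lambda>z. exp (fst z) * g z"
  have h0: "smooth_on ?C ?pot"
  proof -
    have "smooth_on UNIV (exp :: real \<Rightarrow> real)" by (rule smooth_on_Ck[OF open_UNIV Ck_on_exp]) simp
    then show ?thesis
      by (rule smooth_on_bilinear[OF bounded_bilinear_mult smooth_on_compose[OF fst_smooth] g]) simp
  qed
  let ?h = "\<lambda>q. ?pot (?\<Theta> q)"
  have h: "smooth_on L ?h" by (rule smooth_on_compose[OF \<Theta> h0 \<Theta>C])
  have "exact_lagrangian L"
  proof (rule exact_lagrangian_of_primitive[OF Lsub h])
    fix q v assume q: "q \<in> L" and "v \<in> tangent_space L q"
    then obtain \<gamma> where \<gamma>: "curve_through L q v \<gamma>" unfolding tangent_space_def by blast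
    obtain w where \<beta>: "curve_through ?C (?\<Theta> q) w (\<lambda>r. ?\<Theta> (\<gamma> r))"
      by (rule curve_through_smooth_image[OF \<Theta> \<Theta>C \<gamma>])
    obtain v' l where v': "((\<lambda>r. \<Phi> (?\<Theta> (\<gamma> r))) has_vector_derivative v') (at 0)"
      and l: "((\<lambda>r. ?pot (?\<Theta> (\<gamma> r))) has_vector_derivative l) (at 0)"
      and eq: "liouville_form (\<Phi> (?\<Theta> q)) v' = l"
      by (rule liouville_form_on_trace[where F = F and s = s and s' = s' and K = \<Lambda>\<^sub>m,
            folded F'_def, folded H_def, folded g_def, folded \<Phi>_def, OF F leg s(1,3,4) g \<beta>])
    obtain e where e: "e > 0" "\<And>r. r \<in> {-e<..<e} \<Longrightarrow> \<gamma> r \<in> L"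
      and d\<gamma>: "(\<gamma> has_vector_derivative v) (at 0)"
      by (rule curve_throughE[OF \<gamma>]) (rule that)
    have "(\<gamma> has_vector_derivative v') (at 0)"
      by (rule has_vector_derivative_transform_within_open[OF v', of "{-e<..<e}"])
        (use e \<Phi>\<Theta> in auto)
    then have "v' = v" using d\<gamma> by (rule vector_derivative_unique_at)
    moreover have "differential_on L ?h q v = l" by (rule differential_on_curve[OF h \<gamma> l])
    ultimately show "liouville_form q v = differential_on L ?h q v" using eq \<Phi>\<Theta>[OF q] by simp
  qed
  with cob show ?thesis unfolding exact_lagrangian_cobordism_def by blast
qed

end
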